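(* Let $\Lambda$ be a $k$-graph with fundamental groupoid $\mathcal G(\Lambda)$. The functors \[ (V,\mathcal G(\Lambda))\mapsto(\Lambda*V,p_\Lambda),\quad \phi\mapsto \mathrm{id}_\Lambda*\phi \] (from actions of $\mathcal G(\Lambda)$ to coverings of $\Lambda$) and \[ (\Omega,p)\mapsto(\Omega^0,\mathcal G(\Lambda)),\quad \phi\mapsto\phi|_{\Omega^0} \] (from coverings of $\Lambda$ to actions of $\mathcal G(\Lambda)$), described in the context, give an equivalence between the category of coverings of $\Lambda$ and the category of actions of $\mathcal G(\Lambda)$.
   Context: A $k$-graph is a small category $\Lambda$ with a functor $d:\Lambda\to\mathbb N^k$ (the degree) satisfying the factorization property: if $d(\alpha)=n+l$ with $n,l\in\mathbb N^k$, there are unique $\beta,\gamma\in\Lambda$ with $d(\beta)=n$, $d(\gamma)=l$, $\alpha=\beta\gamma$. $\Lambda^0$ is the set of objects (vertices, identified with identity morphisms); $s(\alpha)$ and $r(\alpha)$ are the domain and codomain of $\alpha$. $u\Lambda=r^{-1}(u)$, $\Lambda v=s^{-1}(v)$. A $k$-graph morphism is a degree-preserving functor. A covering of $\Lambda$ is a surjective $k$-graph morphism $p:\Omega\to\Lambda$ such that for all $v\in\Omega^0$, $p$ maps $\Omega v$ bijectively onto $\Lambda p(v)$ and $v\Omega$ bijectively onto $p(v)\Lambda$. A morphism of coverings $(\Omega,p)\to(\Sigma,q)$ of $\Lambda$ is a $k$-graph morphism $\phi:\Omega\to\Sigma$ with $q\circ\phi=p$. The fundamental groupoid of $\Lambda$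 is the groupoid $\mathcal G(\Lambda)$ with $\mathcal G(\Lambda)^0=\Lambda^0$, together with a functor $i:\Lambda\to\mathcal G(\Lambda)$ that is the identity on $\Lambda^0$, such that every functor from $\Lambda$ to a groupoid factors uniquely through $i$. An action of a groupoid $\mathcal G$ on a set $V$ is a functor $T$ from $\mathcal G$ to sets such that $V$ is the disjoint union of the sets $V_x:=T(x)$, $x\in\mathcal G^0$; write $av=T(a)(v)$ for $v\in V_{s(a)}$. A morphism of actions $(V,\mathcal G)\to(U,\mathcal G)$ is a $\mathcal G$-equivariant map $\phi:V\to U$, i.e. a natural transformation of the functors (so $\phi(V_x)\subset U_x$ and $\phi(av)=a\phi(v)$). From actions to coverings: given an action of $\mathcal G(\Lambda)$ on $V$, put $\Lambda*V=\{(\alpha,v)\in\Lambda\times V\mid v\in V_{s(\alpha)}\}$ and $\alpha v=i(\alpha)v$; this is a $k$-graph with $s(\alpha,v)=(s(\alpha),v)$, $r(\alpha,v)=(r(\alpha),\alpha v)$, $(\alpha,\beta v)(\beta,v)=(\alpha\beta,v)$, $d(\alpha,v)=d(\alpha)$, and the coordinate projection $p_\Lambda:\Lambda*V\to\Lambda$ is a covering; $(\mathrm{id}_\Lambda*\phi)(\alpha,v)=(\alpha,\phi(v))$. From coverings to actions: given a covering $p:\Omega\to\Lambda$, $\mathcal G(\Lambda)$ acts on $\Omega^0$, with fibres $p^{-1}(x)$, $x\in\Lambda^0$, by the unique action satisfying $i(\alpha)v=r(\lambda)$ if $\alpha=p(\lambda)$ and $v=s(\lambda)$, $\lambda\in\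Omega$.
   Formalization: Actions are required to have all fibres V_x nonempty, since otherwise p_Λ is not surjective and so not a covering (e.g. V empty); coverings are taken, up to isomorphism, with morphisms represented as pairs (p(λ), s(λ)). *)

theory Defs
  imports "HOL-Library.FuncSet" "HOL-Library.Function_Algebras"
begin

section \<open>Small categories, functors, equivalences\<close>

record ('o, 'm) cat =
  Obj :: "'o set"
  Arr :: "'m set"
  src :: "'m \<Rightarrow> 'o"
  tgt :: "'m \<Rightarrow> 'o"
  ident :: "'o \<Rightarrow> 'm"
  cmp :: "'m \<Rightarrow> 'm \<Rightarrow> 'm"

text \<open>\<open>cmp C g f\<close> is the composite \<open>g f\<close> (first \<open>f\<close>, then \<open>g\<close>); it is meaningful
  when \<open>src C g = tgt C f\<close>.\<close>

definition category :: "('o, 'm, 'z) cat_scheme \<Rightarrow> bool" where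
  "category C \<longleftrightarrow>
     (\<forall>f\<in>Arr C. src C f \<in> Obj C \<and> tgt C f \<in> Obj C) \<and>
     (\<forall>x\<in>Obj C. ident C x \<in> Arr C \<and> src C (ident C x) = x \<and> tgt C (ident C x) = x) \<and>
     (\<forall>g\<in>Arr C. \<forall>f\<in>Arr C. src C g = tgt C f \<longrightarrow>
        cmp C g f \<in> Arr C \<and> src C (cmp C g f) = src C f \<and> tgt C (cmp C g f) = tgt C g) \<and>
     (\<forall>f\<in>Arr C. cmp C f (ident C (src C f)) = f \<and> cmp C (ident C (tgt C f)) f = f) \<and>
     (\<forall>h\<in>Arr C. \<forall>g\<in>Arr C. \<forall>f\<in>Arr C. src C h = tgt C g \<longrightarrow> src C g = tgt C f \<longrightarrow>
        cmp C h (cmp C g f) = cmp C (cmp C h g) f)"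

definition is_iso :: "('o, 'm, 'z) cat_scheme \<Rightarrow> 'm \<Rightarrow> bool" where
  "is_iso C f \<longleftrightarrow> f \<in> Arr C \<and>
     (\<exists>g\<in>Arr C. src C g = tgt C f \<and> tgt C g = src C f \<and>
        cmp C g f = ident C (src C f) \<and> cmp C f g = ident C (tgt C f))"

definition groupoid :: "('o, 'm, 'z) cat_scheme \<Rightarrow> bool" where
  "groupoid C \<longleftrightarrow> category C \<and> (\<forall>f\<in>Arr C. is_iso C f)"

record ('o, 'm, 'p, 'n) fctr =
  FObj :: "'o \<Rightarrow> 'p"
  FArr :: "'m \<Rightarrow> 'n"

text \<open>Functors are extensional (equal to \<open>undefined\<close> off the objects and arrows of the
  source), so that equality of functors is equality in HOL.\<close>

definition is_functor ::
  "('o, 'm, 'z) cat_scheme \<Rightarrow> ('p, 'n, 'y) cat_scheme \<Rightarrow> ('o, 'm, 'p, 'n) fctr \<Rightarrow> bool" where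
  "is_functor C D F \<longleftrightarrow>
     FObj F \<in> Obj C \<rightarrow>\<^sub>E Obj D \<and> FArr F \<in> Arr C \<rightarrow>\<^sub>E Arr D \<and>
     (\<forall>f\<in>Arr C. src D (FArr F f) = FObj F (src C f) \<and> tgt D (FArr F f) = FObj F (tgt C f)) \<and>
     (\<forall>x\<in>Obj C. FArr F (ident C x) = ident D (FObj F x)) \<and>
     (\<forall>g\<in>Arr C. \<forall>f\<in>Arr C. src C g = tgt C f \<longrightarrow>
        FArr F (cmp C g f) = cmp D (FArr F g) (FArr F f))"

definition fid :: "('o, 'm, 'z) cat_scheme \<Rightarrow> ('o, 'm, 'o, 'm) fctr" where
  "fid C = \<lparr>FObj = restrict (\<lambda>x. x) (Obj C), FArr = restrict (\<lambda>f. f) (Arr C)\<rparr>"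

text \<open>\<open>fcomp C G F\<close> is \<open>G \<circ> F\<close>, where \<open>C\<close> is the source of \<open>F\<close>.\<close>

definition fcomp :: "('o, 'm, 'z) cat_scheme \<Rightarrow> ('p, 'n, 'q, 'l) fctr \<Rightarrow>
    ('o, 'm, 'p, 'n) fctr \<Rightarrow> ('o, 'm, 'q, 'l) fctr" where
  "fcomp C G F = \<lparr>FObj = compose (Obj C) (FObj G) (FObj F),
                  FArr = compose (Arr C) (FArr G) (FArr F)\<rparr>"

definition natural_iso :: "('o, 'm, 'z) cat_scheme \<Rightarrow> ('p, 'n, 'y) cat_scheme \<Rightarrow>
    ('o, 'm, 'p, 'n) fctr \<Rightarrow> ('o, 'm, 'p, 'n) fctr \<Rightarrow> ('o \<Rightarrow> 'n) \<Rightarrow> bool" where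
  "natural_iso C D F G \<tau> \<longleftrightarrow>
     (\<forall>x\<in>Obj C. is_iso D (\<tau> x) \<and> src D (\<tau> x) = FObj F x \<and> tgt D (\<tau> x) = FObj G x) \<and>
     (\<forall>f\<in>Arr C. cmp D (\<tau> (tgt C f)) (FArr F f) = cmp D (FArr G f) (\<tau> (src C f)))"

definition category_equivalence :: "('o, 'm, 'z) cat_scheme \<Rightarrow> ('p, 'n, 'y) cat_scheme \<Rightarrow>
    ('o, 'm, 'p, 'n) fctr \<Rightarrow> ('p, 'n, 'o, 'm) fctr \<Rightarrow> bool" where
  "category_equivalence C D F G \<longleftrightarrow>
     category C \<and> category D \<and> is_functor C D F \<and> is_functor D C G \<and>
     (\<exists>\<eta>. natural_iso C C (fid C) (fcomp C G F) \<eta>) \<and>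
     (\<exists>\<epsilon>. natural_iso D D (fcomp D F G) (fid D) \<epsilon>)"

section \<open>Higher-rank graphs and their coverings\<close>

text \<open>The monoid \<open>\<nat>\<^sup>k\<close>, with pointwise addition, as the functions on \<open>nat\<close> vanishing from
  \<open>k\<close> on.\<close>

definition Nk :: "nat \<Rightarrow> (nat \<Rightarrow> nat) set" where
  "Nk k = {n. \<forall>j\<ge>k. n j = 0}"

record ('o, 'm) kgraph = "('o, 'm) cat" +
  deg :: "'m \<Rightarrow> nat \<Rightarrow> nat"

definition k_graph :: "nat \<Rightarrow> ('o, 'm) kgraph \<Rightarrow> bool" where
  "k_graph k \<Lambda> \<longleftrightarrow> category \<Lambda> \<and>
     (\<forall>\<alpha>\<in>Arr \<Lambda>. deg \<Lambda> \<alpha> \<in> Nk k) \<and>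
     (\<forall>x\<in>Obj \<Lambda>. deg \<Lambda> (ident \<Lambda> x) = 0) \<and>
     (\<forall>\<beta>\<in>Arr \<Lambda>. \<forall>\<gamma>\<in>Arr \<Lambda>. src \<Lambda> \<beta> = tgt \<Lambda> \<gamma> \<longrightarrow> deg \<Lambda> (cmp \<Lambda> \<beta> \<gamma>) = deg \<Lambda> \<beta> + deg \<Lambda> \<gamma>) \<and>
     (\<forall>\<alpha>\<in>Arr \<Lambda>. \<forall>n\<in>Nk k. \<forall>l\<in>Nk k. deg \<Lambda> \<alpha> = n + l \<longrightarrow>
        (\<exists>!(\<beta>, \<gamma>). \<beta> \<in> Arr \<Lambda> \<and> \<gamma> \<in> Arr \<Lambda> \<and> src \<Lambda> \<beta> = tgt \<Lambda> \<gamma> \<and>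
           deg \<Lambda> \<beta> = n \<and> deg \<Lambda> \<gamma> = l \<and> \<alpha> = cmp \<Lambda> \<beta> \<gamma>))"

definition kgraph_morphism ::
  "('o, 'm) kgraph \<Rightarrow> ('p, 'n) kgraph \<Rightarrow> ('o, 'm, 'p, 'n) fctr \<Rightarrow> bool" where
  "kgraph_morphism \<Omega> \<Lambda> p \<longleftrightarrow> is_functor \<Omega> \<Lambda> p \<and> (\<forall>\<mu>\<in>Arr \<Omega>. deg \<Lambda> (FArr p \<mu>) = deg \<Omega> \<mu>)"

definition arrows_from :: "('o, 'm, 'z) cat_scheme \<Rightarrow> 'o \<Rightarrow> 'm set" where
  "arrows_from C v = {f \<in> Arr C. src C f = v}"

definition arrows_to :: "('o, 'm, 'z) cat_scheme \<Rightarrow> 'o \<Rightarrow> 'm set" where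
  "arrows_to C v = {f \<in> Arr C. tgt C f = v}"

definition covering ::
  "nat \<Rightarrow> ('x, 'a) kgraph \<Rightarrow> ('v, 'm) kgraph \<Rightarrow> ('v, 'm, 'x, 'a) fctr \<Rightarrow> bool" where
  "covering k \<Lambda> \<Omega> p \<longleftrightarrow> k_graph k \<Omega> \<and> kgraph_morphism \<Omega> \<Lambda> p \<and>
     FObj p ` Obj \<Omega> = Obj \<Lambda> \<and> FArr p ` Arr \<Omega> = Arr \<Lambda> \<and>
     (\<forall>v\<in>Obj \<Omega>. bij_betw (FArr p) (arrows_from \<Omega> v) (arrows_from \<Lambda> (FObj p v)) \<and>
                bij_betw (FArr p) (arrows_to \<Omega> v) (arrows_to \<Lambda> (FObj p v)))"

definition covering_morphism ::
  "('v, 'm) kgraph \<Rightarrow> ('v, 'm, 'x, 'a) fctr \<Rightarrow> ('w, 'n) kgraph \<Rightarrow> ('w, 'n, 'x, 'a) fctr \<Rightarrow>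
   ('v, 'm, 'w, 'n) fctr \<Rightarrow> bool" where
  "covering_morphism \<Omega> p \<Sigma> q \<phi> \<longleftrightarrow> kgraph_morphism \<Omega> \<Sigma> \<phi> \<and> fcomp \<Omega> q \<phi> = p"

text \<open>Coverings have their vertices in a type \<open>'v\<close> and their morphisms in \<open>'a \<times> 'v\<close>, where
  \<open>'a\<close> is the type of morphisms of \<open>\<Lambda>\<close>. The choice of \<open>'a \<times> 'v\<close> loses nothing: a morphism
  \<open>\<mu>\<close> of a covering is determined by \<open>p \<mu>\<close> and \<open>s \<mu>\<close>, so every covering with vertices in
  \<open>'v\<close> is isomorphic to one of this form (\<open>covering_relabel\<close> below).\<close>

type_synonym ('x, 'a, 'v) cov = "('v, 'a \<times> 'v) kgraph \<times> ('v, 'a \<times> 'v, 'x, 'a) fctr"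

type_synonym ('x, 'a, 'v) cov_arrow =
  "('x, 'a, 'v) cov \<times> ('v, 'a \<times> 'v, 'v, 'a \<times> 'v) fctr \<times> ('x, 'a, 'v) cov"

definition covering_cat ::
  "nat \<Rightarrow> ('x, 'a) kgraph \<Rightarrow> (('x, 'a, 'v) cov, ('x, 'a, 'v) cov_arrow) cat" where
  "covering_cat k \<Lambda> = \<lparr>
     Obj = {(\<Omega>, p). covering k \<Lambda> \<Omega> p},
     Arr = {((\<Omega>, p), \<phi>, (\<Sigma>, q)). covering k \<Lambda> \<Omega> p \<and> covering k \<Lambda> \<Sigma> q \<and>
                                covering_morphism \<Omega> p \<Sigma> q \<phi>},
     src = (\<lambda>(X, \<phi>, Y). X),
     tgt = (\<lambda>(X, \<phi>, Y). Y),
     ident = (\<lambda>(\<Omega>, p). ((\<Omega>, p), fid \<Omega>, (\<Omega>, p))),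
     cmp = (\<lambda>(Y', \<psi>, Z) (X, \<phi>, Y). (X, fcomp (fst X) \<psi> \<phi>, Z))\<rparr>"

section \<open>Groupoid actions\<close>

text \<open>The category of sets with elements in \<open>'v\<close>; an arrow is a triple (source, map, target).\<close>

type_synonym 'v set_arrow = "'v set \<times> ('v \<Rightarrow> 'v) \<times> 'v set"

type_synonym 'v sets = "('v set, 'v set_arrow) cat"

definition set_cat :: "'v sets" where
  "set_cat = \<lparr>
     Obj = UNIV,
     Arr = {(A, f, B). f \<in> A \<rightarrow>\<^sub>E B},
     src = (\<lambda>(A, f, B). A),
     tgt = (\<lambda>(A, f, B). B),
     ident = (\<lambda>A. (A, restrict (\<lambda>x. x) A, A)),
     cmp = (\<lambda>(B', g, C) (A, f, B). (A, compose A g f, C))\<rparr>"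

type_synonym ('x, 'g, 'v) set_functor = "('x, 'g, 'v set, 'v set_arrow) fctr"

definition action :: "('x, 'g) cat \<Rightarrow> 'v set \<Rightarrow> ('x, 'g, 'v) set_functor \<Rightarrow> bool" where
  "action G V T \<longleftrightarrow> is_functor G set_cat T \<and>
     V = (\<Union>x\<in>Obj G. FObj T x) \<and>
     (\<forall>x\<in>Obj G. \<forall>y\<in>Obj G. x \<noteq> y \<longrightarrow> FObj T x \<inter> FObj T y = {})"

definition act :: "('x, 'g, 'v) set_functor \<Rightarrow> 'g \<Rightarrow> 'v \<Rightarrow> 'v" where
  "act T a v = (case FArr T a of (A, f, B) \<Rightarrow> f v)"

definition action_morphism :: "('x, 'g) cat \<Rightarrow> 'v set \<Rightarrow> ('x, 'g, 'v) set_functor \<Rightarrow>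
    'v set \<Rightarrow> ('x, 'g, 'v) set_functor \<Rightarrow> ('v \<Rightarrow> 'v) \<Rightarrow> bool" where
  "action_morphism G V T U S \<phi> \<longleftrightarrow> \<phi> \<in> V \<rightarrow>\<^sub>E U \<and>
     (\<forall>x\<in>Obj G. \<phi> ` FObj T x \<subseteq> FObj S x) \<and>
     (\<forall>a\<in>Arr G. \<forall>v\<in>FObj T (src G a). \<phi> (act T a v) = act S a (\<phi> v))"

text \<open>Coverings are surjective and the image of \<open>p\<^sub>\<Lambda> : \<Lambda> * V \<rightarrow> \<Lambda>\<close> contains the vertex \<open>x\<close> iff
  \<open>V\<^sub>x \<noteq> {}\<close>. Hence only actions all of whose fibres are nonempty give rise to coverings,
  and these are the objects of the category of actions.\<close>

definition fibres_nonempty :: "('x, 'g) cat \<Rightarrow> ('x, 'g, 'v) set_functor \<Rightarrow> bool" where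
  "fibres_nonempty G T \<longleftrightarrow> (\<forall>x\<in>Obj G. FObj T x \<noteq> {})"

type_synonym ('x, 'g, 'v) actn = "'v set \<times> ('x, 'g, 'v) set_functor"

type_synonym ('x, 'g, 'v) actn_arrow = "('x, 'g, 'v) actn \<times> ('v \<Rightarrow> 'v) \<times> ('x, 'g, 'v) actn"

definition action_cat ::
  "('x, 'g) cat \<Rightarrow> (('x, 'g, 'v) actn, ('x, 'g, 'v) actn_arrow) cat" where
  "action_cat G = \<lparr>
     Obj = {(V, T). action G V T \<and> fibres_nonempty G T},
     Arr = {((V, T), \<phi>, (U, S)). action G V T \<and> fibres_nonempty G T \<and>
                                action G U S \<and> fibres_nonempty G S \<and>
                                action_morphism G V T U S \<phi>},
     src = (\<lambda>(X, \<phi>, Y). X),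
     tgt = (\<lambda>(X, \<phi>, Y). Y),
     ident = (\<lambda>(V, T). ((V, T), restrict (\<lambda>v. v) V, (V, T))),
     cmp = (\<lambda>(Y', \<psi>, Z) (X, \<phi>, Y). (X, compose (fst X) \<psi> \<phi>, Z))\<rparr>"

section \<open>The fundamental groupoid\<close>

text \<open>The universal property is stated for groupoids with objects and arrows in given types
  \<open>'y\<close> and \<open>'h\<close>, since HOL cannot quantify over types. As a hypothesis, the instance at a
  single choice of types is implied by the property for all groupoids. For actions on subsets
  of \<open>'v\<close> the relevant instance is \<open>'v sets\<close>, the type of \<open>set_cat\<close>: groupoids of bijections
  between subsets of \<open>'v\<close> live there.\<close>

definition fundamental_groupoid :: "('y, 'h) cat itself \<Rightarrow> ('x, 'a) kgraph \<Rightarrow>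
    ('x, 'g) cat \<Rightarrow> ('x, 'a, 'x, 'g) fctr \<Rightarrow> bool" where
  "fundamental_groupoid _ \<Lambda> G i \<longleftrightarrow>
     groupoid G \<and> Obj G = Obj \<Lambda> \<and> is_functor \<Lambda> G i \<and> (\<forall>x\<in>Obj \<Lambda>. FObj i x = x) \<and>
     (\<forall>(H :: ('y, 'h) cat) F. groupoid H \<longrightarrow> is_functor \<Lambda> H F \<longrightarrow>
        (\<exists>!F'. is_functor G H F' \<and> fcomp \<Lambda> F' i = F))"

section \<open>From actions to coverings\<close>

definition base_point :: "('x, 'a) kgraph \<Rightarrow> ('x, 'g, 'v) set_functor \<Rightarrow> 'v \<Rightarrow> 'x" where
  "base_point \<Lambda> T v = (THE x. x \<in> Obj \<Lambda> \<and> v \<in> FObj T x)"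

text \<open>The vertex \<open>(x, v)\<close> of \<open>\<Lambda> * V\<close> is represented by \<open>v\<close> alone, its first component being
  \<open>base_point \<Lambda> T v\<close>; the corresponding identity morphism is \<open>(id\<^sub>x, v)\<close>.\<close>

definition star_graph :: "('x, 'a) kgraph \<Rightarrow> ('x, 'a, 'x, 'g) fctr \<Rightarrow>
    'v set \<Rightarrow> ('x, 'g, 'v) set_functor \<Rightarrow> ('v, 'a \<times> 'v) kgraph" where
  "star_graph \<Lambda> i V T = \<lparr>
     Obj = V,
     Arr = {(\<alpha>, v). \<alpha> \<in> Arr \<Lambda> \<and> v \<in> FObj T (src \<Lambda> \<alpha>)},
     src = (\<lambda>(\<alpha>, v). v),
     tgt = (\<lambda>(\<alpha>, v). act T (FArr i \<alpha>) v),
     ident = (\<lambda>v. (ident \<Lambda> (base_point \<Lambda> T v), v)),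
     cmp = (\<lambda>(\<alpha>, w) (\<beta>, v). (cmp \<Lambda> \<alpha> \<beta>, v)),
     deg = (\<lambda>(\<alpha>, v). deg \<Lambda> \<alpha>)\<rparr>"

definition star_proj :: "('x, 'a) kgraph \<Rightarrow> ('x, 'a, 'x, 'g) fctr \<Rightarrow>
    'v set \<Rightarrow> ('x, 'g, 'v) set_functor \<Rightarrow> ('v, 'a \<times> 'v, 'x, 'a) fctr" where
  "star_proj \<Lambda> i V T = \<lparr>FObj = restrict (base_point \<Lambda> T) V,
                         FArr = restrict fst (Arr (star_graph \<Lambda> i V T))\<rparr>"

definition star_cov :: "('x, 'a) kgraph \<Rightarrow> ('x, 'a, 'x, 'g) fctr \<Rightarrow>
    ('x, 'g, 'v) actn \<Rightarrow> ('x, 'a, 'v) cov" where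
  "star_cov \<Lambda> i = (\<lambda>(V, T). (star_graph \<Lambda> i V T, star_proj \<Lambda> i V T))"

definition star_map :: "('x, 'a) kgraph \<Rightarrow> ('x, 'a, 'x, 'g) fctr \<Rightarrow>
    ('x, 'g, 'v) actn \<Rightarrow> ('v \<Rightarrow> 'v) \<Rightarrow> ('v, 'a \<times> 'v, 'v, 'a \<times> 'v) fctr" where
  "star_map \<Lambda> i = (\<lambda>(V, T) \<phi>.
     \<lparr>FObj = restrict \<phi> V,
      FArr = restrict (\<lambda>(\<alpha>, v). (\<alpha>, \<phi> v)) (Arr (star_graph \<Lambda> i V T))\<rparr>)"

definition action_to_covering ::
  "('x, 'a) kgraph \<Rightarrow> ('x, 'g) cat \<Rightarrow> ('x, 'a, 'x, 'g) fctr \<Rightarrow>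
   (('x, 'g, 'v) actn, ('x, 'g, 'v) actn_arrow, ('x, 'a, 'v) cov, ('x, 'a, 'v) cov_arrow) fctr"
  where
  "action_to_covering \<Lambda> G i = \<lparr>
     FObj = restrict (star_cov \<Lambda> i) (Obj (action_cat G)),
     FArr = restrict (\<lambda>(X, \<phi>, Y). (star_cov \<Lambda> i X, star_map \<Lambda> i X \<phi>, star_cov \<Lambda> i Y))
              (Arr (action_cat G))\<rparr>"

section \<open>From coverings to actions\<close>

definition lift_action :: "('x, 'g) cat \<Rightarrow> ('x, 'a, 'x, 'g) fctr \<Rightarrow>
    ('v, 'm) kgraph \<Rightarrow> ('v, 'm, 'x, 'a) fctr \<Rightarrow> ('x, 'g, 'v) set_functor" where
  "lift_action G i \<Omega> p = (THE T. action G (Obj \<Omega>) T \<and>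
     (\<forall>x\<in>Obj G. FObj T x = {v \<in> Obj \<Omega>. FObj p v = x}) \<and>
     (\<forall>\<mu>\<in>Arr \<Omega>. act T (FArr i (FArr p \<mu>)) (src \<Omega> \<mu>) = tgt \<Omega> \<mu>))"

definition vertex_action :: "('x, 'g) cat \<Rightarrow> ('x, 'a, 'x, 'g) fctr \<Rightarrow>
    ('x, 'a, 'v) cov \<Rightarrow> ('x, 'g, 'v) actn" where
  "vertex_action G i = (\<lambda>(\<Omega>, p). (Obj \<Omega>, lift_action G i \<Omega> p))"

definition covering_to_action ::
  "nat \<Rightarrow> ('x, 'a) kgraph \<Rightarrow> ('x, 'g) cat \<Rightarrow> ('x, 'a, 'x, 'g) fctr \<Rightarrow>
   (('x, 'a, 'v) cov, ('x, 'a, 'v) cov_arrow, ('x, 'g, 'v) actn, ('x, 'g, 'v) actn_arrow) fctr"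
  where
  "covering_to_action k \<Lambda> G i = \<lparr>
     FObj = restrict (vertex_action G i) (Obj (covering_cat k \<Lambda>)),
     FArr = restrict (\<lambda>((\<Omega>, p), \<phi>, Y).
                (vertex_action G i (\<Omega>, p), restrict (FObj \<phi>) (Obj \<Omega>), vertex_action G i Y))
              (Arr (covering_cat k \<Lambda>))\<rparr>"

section \<open>Every covering has a copy with morphisms in the type of pairs\<close>

lemma covering_relabel:
  fixes \<Lambda> :: "('x, 'a) kgraph" and \<Omega> :: "('v, 'm) kgraph"
  assumes cov: "covering k \<Lambda> \<Omega> p"
  shows "\<exists>(\<Omega>' :: ('v, 'a \<times> 'v) kgraph) p' \<phi> \<psi>. covering k \<Lambda> \<Omega>' p' \<and>
           covering_morphism \<Omega> p \<Omega>' p' \<phi> \<and> covering_morphism \<Omega>' p' \<Omega> p \<psi> \<and>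
           fcomp \<Omega> \<psi> \<phi> = fid \<Omega> \<and> fcomp \<Omega>' \<phi> \<psi> = fid \<Omega>'"
proof -
  define h where "h = (\<lambda>\<mu>. (FArr p \<mu>, src \<Omega> \<mu>))"
  define g where "g = inv_into (Arr \<Omega>) h"
  have kg: "k_graph k \<Omega>" and mor: "kgraph_morphism \<Omega> \<Lambda> p" and cat: "category \<Omega>"
    and fun_p: "is_functor \<Omega> \<Lambda> p"
    using cov by (auto simp: covering_def k_graph_def kgraph_morphism_def)
  have inj: "inj_on h (Arr \<Omega>)"
  proof (rule inj_onI)
    fix a b assume ab: "a \<in> Arr \<Omega>" "b \<in> Arr \<Omega>" "h a = h b"
    let ?v = "src \<Omega> a"
    have "?v \<in> Obj \<Omega>" using cat ab by (auto simp: category_def)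
    then have "inj_on (FArr p) (arrows_from \<Omega> ?v)"
      using cov by (auto simp: covering_def bij_betw_def)
    then show "a = b" using ab by (auto simp: inj_on_def arrows_from_def h_def)
  qed
  have gh [simp]: "g (h a) = a" if "a \<in> Arr \<Omega>" for a
    unfolding g_def using inv_into_f_f[OF inj that] .
  define \<Omega>' :: "('v, 'a \<times> 'v) kgraph" where
    "\<Omega>' = \<lparr>Obj = Obj \<Omega>, Arr = h ` Arr \<Omega>, src = (\<lambda>e. src \<Omega> (g e)), tgt = (\<lambda>e. tgt \<Omega> (g e)),
      ident = (\<lambda>x. h (ident \<Omega> x)), cmp = (\<lambda>e f. h (cmp \<Omega> (g e) (g f))),
      deg = (\<lambda>e. deg \<Omega> (g e))\<rparr>"
  define p' :: "('v, 'a \<times> 'v, 'x, 'a) fctr" where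
    "p' = \<lparr>FObj = FObj p, FArr = restrict (\<lambda>e. FArr p (g e)) (Arr \<Omega>')\<rparr>"
  define \<phi> :: "('v, 'm, 'v, 'a \<times> 'v) fctr" where
    "\<phi> = \<lparr>FObj = restrict (\<lambda>x. x) (Obj \<Omega>), FArr = restrict h (Arr \<Omega>)\<rparr>"
  define \<psi> :: "('v, 'a \<times> 'v, 'v, 'm) fctr" where
    "\<psi> = \<lparr>FObj = restrict (\<lambda>x. x) (Obj \<Omega>), FArr = restrict g (Arr \<Omega>')\<rparr>"
  note c = cat[unfolded category_def]
  have cat': "category \<Omega>'"
    using c unfolding category_def \<Omega>'_def by simp
  have kg': "k_graph k \<Omega>'"
  proof -
    have "\<exists>!(\<beta>, \<gamma>). \<beta> \<in> Arr \<Omega>' \<and> \<gamma> \<in> Arr \<Omega>' \<and> src \<Omega>' \<beta> = tgt \<Omega>' \<gamma> \<and>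
           deg \<Omega>' \<beta> = n \<and> deg \<Omega>' \<gamma> = l \<and> \<alpha> = cmp \<Omega>' \<beta> \<gamma>"
      if A: "\<alpha> \<in> Arr \<Omega>'" "n \<in> Nk k" "l \<in> Nk k" "deg \<Omega>' \<alpha> = n + l" for \<alpha> n l
    proof -
      obtain a where a: "a \<in> Arr \<Omega>" "\<alpha> = h a" using A(1) by (auto simp: \<Omega>'_def)
      have "deg \<Omega> a = n + l" using A(4) a by (simp add: \<Omega>'_def)
      then have "\<exists>!(\<beta>, \<gamma>). \<beta> \<in> Arr \<Omega> \<and> \<gamma> \<in> Arr \<Omega> \<and> src \<Omega> \<beta> = tgt \<Omega> \<gamma> \<and>
           deg \<Omega> \<beta> = n \<and> deg \<Omega> \<gamma> = l \<and> a = cmp \<Omega> \<beta> \<gamma>"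
        using kg a A(2,3) unfolding k_graph_def by blast
      then obtain b e where be: "b \<in> Arr \<Omega>" "e \<in> Arr \<Omega>" "src \<Omega> b = tgt \<Omega> e"
          "deg \<Omega> b = n" "deg \<Omega> e = l" "a = cmp \<Omega> b e"
        and uniq: "\<And>b' e'. b' \<in> Arr \<Omega> \<Longrightarrow> e' \<in> Arr \<Omega> \<Longrightarrow> src \<Omega> b' = tgt \<Omega> e' \<Longrightarrow>
          deg \<Omega> b' = n \<Longrightarrow> deg \<Omega> e' = l \<Longrightarrow> a = cmp \<Omega> b' e' \<Longrightarrow> b' = b \<and> e' = e"
        unfolding Ex1_def by fast
      show ?thesis
      proof (rule ex1I[of _ "(h b, h e)"])
        show "case (h b, h e) of (\<beta>, \<gamma>) \<Rightarrow> \<beta> \<in> Arr \<Omega>' \<and> \<gamma> \<in> Arr \<Omega>' \<and> src \<Omega>' \<beta> = tgt \<Omega>' \<gamma> \<and>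
           deg \<Omega>' \<beta> = n \<and> deg \<Omega>' \<gamma> = l \<and> \<alpha> = cmp \<Omega>' \<beta> \<gamma>"
          using be a by (simp add: \<Omega>'_def)
      next
        fix z assume z: "case z of (\<beta>, \<gamma>) \<Rightarrow> \<beta> \<in> Arr \<Omega>' \<and> \<gamma> \<in> Arr \<Omega>' \<and> src \<Omega>' \<beta> = tgt \<Omega>' \<gamma> \<and>
           deg \<Omega>' \<beta> = n \<and> deg \<Omega>' \<gamma> = l \<and> \<alpha> = cmp \<Omega>' \<beta> \<gamma>"
        obtain b' e' where z': "z = (h b', h e')" "b' \<in> Arr \<Omega>" "e' \<in> Arr \<Omega>"
          using z by (auto simp: \<Omega>'_def)
        have w: "src \<Omega> b' = tgt \<Omega> e'" "deg \<Omega> b' = n" "deg \<Omega> e' = l" "h a = h (cmp \<Omega> b' e')"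
          using z z' a by (simp_all add: \<Omega>'_def)
        have "cmp \<Omega> b' e' \<in> Arr \<Omega>" using c z' w by blast
        then have "a = cmp \<Omega> b' e'" using w(4) a gh by metis
        then show "z = (h b, h e)" using uniq z' w by blast
      qed
    qed
    then show ?thesis
      using kg c cat' unfolding k_graph_def by (simp add: \<Omega>'_def)
  qed
  have fp': "kgraph_morphism \<Omega>' \<Lambda> p'"
    using mor c unfolding kgraph_morphism_def is_functor_def p'_def \<Omega>'_def by auto
  have imp: "FArr p' ` Arr \<Omega>' = FArr p ` Arr \<Omega>"
    by (auto simp: p'_def \<Omega>'_def image_image)
  have bij: "bij_betw (FArr p') (h ` A) B" if "bij_betw (FArr p) A B" "A \<subseteq> Arr \<Omega>" for A B
  proof -
    have "bij_betw g (h ` A) A"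
      using that(2) by (intro bij_betw_byWitness[where f' = h]) auto
    then have "bij_betw (FArr p \<circ> g) (h ` A) B" using that(1) by (rule bij_betw_trans)
    moreover have "(FArr p \<circ> g) e = FArr p' e" if "e \<in> h ` A" for e
      using that \<open>A \<subseteq> Arr \<Omega>\<close> by (auto simp: p'_def \<Omega>'_def)
    ultimately show ?thesis using bij_betw_cong by blast
  qed
  have fr: "arrows_from \<Omega>' v = h ` arrows_from \<Omega> v" "arrows_to \<Omega>' v = h ` arrows_to \<Omega> v" for v
    by (auto simp: arrows_from_def arrows_to_def \<Omega>'_def)
  have sub: "arrows_from \<Omega> v \<subseteq> Arr \<Omega>" "arrows_to \<Omega> v \<subseteq> Arr \<Omega>" for v
    by (auto simp: arrows_from_def arrows_to_def)
  have o: "Obj \<Omega>' = Obj \<Omega>" "FObj p' = FObj p" by (simp_all add: \<Omega>'_def p'_def)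
  have "covering k \<Lambda> \<Omega>' p'"
    using cov kg' fp' imp bij sub unfolding covering_def fr o by simp
  moreover have "covering_morphism \<Omega> p \<Omega>' p' \<phi>"
  proof -
    have "kgraph_morphism \<Omega> \<Omega>' \<phi>"
      using c unfolding kgraph_morphism_def is_functor_def \<phi>_def \<Omega>'_def by auto
    moreover have "fcomp \<Omega> p' \<phi> = p"
    proof -
      have "FObj (fcomp \<Omega> p' \<phi>) = FObj p" "FArr (fcomp \<Omega> p' \<phi>) = FArr p"
        using fun_p unfolding is_functor_def
        by (auto simp: fcomp_def p'_def \<phi>_def \<Omega>'_def compose_def fun_eq_iff PiE_def
            extensional_def)
      then show ?thesis by (cases p; cases "fcomp \<Omega> p' \<phi>") simp
    qed
    ultimately show ?thesis by (simp add: covering_morphism_def)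
  qed
  moreover have "covering_morphism \<Omega>' p' \<Omega> p \<psi>"
  proof -
    have "kgraph_morphism \<Omega>' \<Omega> \<psi>"
      using c unfolding kgraph_morphism_def is_functor_def \<psi>_def \<Omega>'_def by auto
    moreover have "fcomp \<Omega>' p \<psi> = p'"
      using fun_p unfolding is_functor_def
      by (auto simp: fcomp_def p'_def \<psi>_def \<Omega>'_def compose_def fun_eq_iff PiE_def extensional_def)
    ultimately show ?thesis by (simp add: covering_morphism_def)
  qed
  moreover have "fcomp \<Omega> \<psi> \<phi> = fid \<Omega>" "fcomp \<Omega>' \<phi> \<psi> = fid \<Omega>'"
    by (auto simp: fcomp_def fid_def \<phi>_def \<psi>_def \<Omega>'_def compose_def fun_eq_iff)
  ultimately show ?thesis by blast
qed

end

theory Submission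
  imports Defs
begin

text \<open>Unique path lifting makes \<open>\<Lambda>\<close> act on the fibres of a covering by bijections, and the
  universal property of \<open>G\<close>, applied to the groupoid of bijections between sets, extends this to
  an action of \<open>G\<close>. Going from an action to its covering and back gives the same action; going
  from a covering \<open>(\<Omega>, p)\<close> to its action and back gives an isomorphic covering, with \<open>\<mu>\<close>
  corresponding to \<open>(p \<mu>, s \<mu>)\<close>. The delicate point is that a morphism of coverings is equivariant
  on vertices for all of \<open>G\<close> and not only for the image of \<open>\<Lambda>\<close>, because the universal property is
  given at a single choice of types. Its kernel and its range are preserved by \<open>\<Lambda>\<close>, hence by \<open>G\<close>;
  pushing the action forward to the range then yields an extension of the action of \<open>\<Lambda>\<close> on the
  target, which is unique.\<close>

section \<open>Categories and functors\<close>

text \<open>The obvious proof of equivariance would apply the universal property to the groupoid of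
  pairs of bijections that commute with \<open>\<phi>\<close>. Its objects are pairs of fibres,
  which are not of type \<open>'v set\<close>, so the hypothesis says nothing about it. What can be
  used is a relation on \<open>'v\<close> alone. This is why \<open>rel_groupoid\<close> carries a
  parameter \<open>R\<close>: constantly true, it gives all bijections and hence existence and
  uniqueness of extensions; equality of \<open>\<phi>\<close>-values gives the kernel; membership in
  the range, read as a relation ignoring one argument, gives the range. Kernel and range together
  replace the commuting pairs. Since \<open>\<phi>\<close> need not be onto, the pushed-forward
  action is completed by the given target action outside the range. The round trip on actions is an
  equality, not only an isomorphism, because the vertices of the star graph are the points of
  \<open>V\<close> themselves; hence the unit is made of identities and only the counit needs a
  construction.\<close>

lemma
  assumes "category C"
  shows category_src: "f \<in> Arr C \<Longrightarrow> src C f \<in> Obj C"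
    and category_tgt: "f \<in> Arr C \<Longrightarrow> tgt C f \<in> Obj C"
    and category_ident: "x \<in> Obj C \<Longrightarrow> ident C x \<in> Arr C"
    and category_src_ident: "x \<in> Obj C \<Longrightarrow> src C (ident C x) = x"
    and category_tgt_ident: "x \<in> Obj C \<Longrightarrow> tgt C (ident C x) = x"
    and category_cmp: "g \<in> Arr C \<Longrightarrow> f \<in> Arr C \<Longrightarrow> src C g = tgt C f \<Longrightarrow> cmp C g f \<in> Arr C"
    and category_src_cmp:
      "g \<in> Arr C \<Longrightarrow> f \<in> Arr C \<Longrightarrow> src C g = tgt C f \<Longrightarrow> src C (cmp C g f) = src C f"
    and category_tgt_cmp:
      "g \<in> Arr C \<Longrightarrow> f \<in> Arr C \<Longrightarrow> src C g = tgt C f \<Longrightarrow> tgt C (cmp C g f) = tgt C g"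
    and category_cmp_ident: "f \<in> Arr C \<Longrightarrow> cmp C f (ident C (src C f)) = f"
    and category_ident_cmp: "f \<in> Arr C \<Longrightarrow> cmp C (ident C (tgt C f)) f = f"
    and category_assoc:
      "h \<in> Arr C \<Longrightarrow> g \<in> Arr C \<Longrightarrow> f \<in> Arr C \<Longrightarrow> src C h = tgt C g \<Longrightarrow> src C g = tgt C f \<Longrightarrow>
        cmp C h (cmp C g f) = cmp C (cmp C h g) f"
  using assms unfolding category_def by blast+

lemmas category_rules = category_src category_tgt category_ident category_src_ident
  category_tgt_ident category_cmp category_src_cmp category_tgt_cmp category_cmp_ident
  category_ident_cmp category_assoc

lemma
  assumes "is_functor C D F"
  shows functor_Obj: "x \<in> Obj C \<Longrightarrow> FObj F x \<in> Obj D"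
    and functor_Arr: "f \<in> Arr C \<Longrightarrow> FArr F f \<in> Arr D"
    and functor_src: "f \<in> Arr C \<Longrightarrow> src D (FArr F f) = FObj F (src C f)"
    and functor_tgt: "f \<in> Arr C \<Longrightarrow> tgt D (FArr F f) = FObj F (tgt C f)"
    and functor_ident: "x \<in> Obj C \<Longrightarrow> FArr F (ident C x) = ident D (FObj F x)"
    and functor_cmp: "g \<in> Arr C \<Longrightarrow> f \<in> Arr C \<Longrightarrow> src C g = tgt C f \<Longrightarrow>
      FArr F (cmp C g f) = cmp D (FArr F g) (FArr F f)"
    and functor_extensional_Obj: "FObj F \<in> extensional (Obj C)"
    and functor_extensional_Arr: "FArr F \<in> extensional (Arr C)"
  using assms unfolding is_functor_def by (auto simp: PiE_def)

lemmas functor_rules = functor_Obj functor_Arr functor_src functor_tgt functor_ident functor_cmp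

lemma is_functorI:
  assumes "FObj F \<in> extensional (Obj C)" "FArr F \<in> extensional (Arr C)"
    and "\<And>x. x \<in> Obj C \<Longrightarrow> FObj F x \<in> Obj D"
    and "\<And>f. f \<in> Arr C \<Longrightarrow> FArr F f \<in> Arr D"
    and "\<And>f. f \<in> Arr C \<Longrightarrow> src D (FArr F f) = FObj F (src C f)"
    and "\<And>f. f \<in> Arr C \<Longrightarrow> tgt D (FArr F f) = FObj F (tgt C f)"
    and "\<And>x. x \<in> Obj C \<Longrightarrow> FArr F (ident C x) = ident D (FObj F x)"
    and "\<And>g f. g \<in> Arr C \<Longrightarrow> f \<in> Arr C \<Longrightarrow> src C g = tgt C f \<Longrightarrow>
      FArr F (cmp C g f) = cmp D (FArr F g) (FArr F f)"
  shows "is_functor C D F"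
  using assms unfolding is_functor_def by (simp add: PiE_iff)

text \<open>Both functors are \<open>undefined\<close> off the objects and arrows of
  \<open>C\<close>, so values on \<open>C\<close> decide equality; targets do not enter, which is
  why they may differ.\<close>

lemma functor_eqI:
  assumes "is_functor C D F" "is_functor C D' F'"
    and "\<And>x. x \<in> Obj C \<Longrightarrow> FObj F x = FObj F' x"
    and "\<And>f. f \<in> Arr C \<Longrightarrow> FArr F f = FArr F' f"
  shows "F = F'"
proof -
  have "FObj F = FObj F'"
    using assms(3) by (intro extensionalityI[OF functor_extensional_Obj[OF assms(1)]
        functor_extensional_Obj[OF assms(2)]])
  moreover have "FArr F = FArr F'"
    using assms(4) by (intro extensionalityI[OF functor_extensional_Arr[OF assms(1)]
        functor_extensional_Arr[OF assms(2)]])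
  ultimately show ?thesis by (cases F; cases F') simp
qed

lemma
  shows FObj_fcomp: "x \<in> Obj C \<Longrightarrow> FObj (fcomp C G F) x = FObj G (FObj F x)"
    and FArr_fcomp: "f \<in> Arr C \<Longrightarrow> FArr (fcomp C G F) f = FArr G (FArr F f)"
    and FObj_fid: "x \<in> Obj C \<Longrightarrow> FObj (fid C) x = x"
    and FArr_fid: "f \<in> Arr C \<Longrightarrow> FArr (fid C) f = f"
  by (simp_all add: fcomp_def fid_def compose_eq)

lemmas fctr_simps = FObj_fcomp FArr_fcomp FObj_fid FArr_fid

lemma is_functor_fid:
  assumes "category C"
  shows "is_functor C C (fid C)"
  by (rule is_functorI) (auto simp: fid_def category_rules[OF assms])

lemma is_functor_fcomp:
  assumes "category C" "is_functor C D F" "is_functor D E G"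
  shows "is_functor C E (fcomp C G F)"
  by (rule is_functorI)
    (simp_all add: fctr_simps category_rules[OF assms(1)] functor_rules[OF assms(2)]
      functor_rules[OF assms(3)], simp_all add: fcomp_def)

lemma fcomp_fid:
  assumes "category C" "is_functor C D F"
  shows "fcomp C F (fid C) = F"
  by (rule functor_eqI[OF is_functor_fcomp[OF assms(1) is_functor_fid[OF assms(1)] assms(2)]
        assms(2)]) (simp_all add: fctr_simps)

lemma fid_fcomp:
  assumes "category C" "category D" "is_functor C D F"
  shows "fcomp C (fid D) F = F"
  by (rule functor_eqI[OF is_functor_fcomp[OF assms(1,3) is_functor_fid[OF assms(2)]] assms(3)])
    (simp_all add: fctr_simps functor_rules[OF assms(3)])

lemma fcomp_assoc:
  assumes "category C" "category D" "is_functor C D F" "is_functor D E G" "is_functor E E' H"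
  shows "fcomp C H (fcomp C G F) = fcomp C (fcomp D H G) F"
  by (rule functor_eqI[where D = E' and D' = E'])
    (auto simp: fctr_simps functor_rules[OF assms(3)] intro!: is_functor_fcomp assms
      is_functor_fcomp[where D = E] is_functor_fcomp[where D = D])

lemma is_iso_ident:
  assumes "category C" "x \<in> Obj C"
  shows "is_iso C (ident C x)"
proof -
  have "cmp C (ident C x) (ident C x) = ident C x"
    using category_cmp_ident[OF assms(1) category_ident[OF assms]]
      category_src_ident[OF assms] by simp
  then show ?thesis
    by (auto simp: is_iso_def category_rules[OF assms(1)] assms(2) intro!: bexI[of _ "ident C x"])
qed

lemma natural_iso_ident:
  assumes "category C"
  shows "natural_iso C C (fid C) (fid C) (ident C)"
  by (simp add: natural_iso_def is_iso_ident[OF assms] category_rules[OF assms] fctr_simps)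

section \<open>Groupoid actions\<close>

text \<open>An arrow of \<open>set_cat\<close> is a triple whose outer entries are forced by
  functoriality. A functor to sets is therefore the same as its fibres together with the maps
  \<open>act T a\<close>, and all later work is done with these two.\<close>

lemma
  assumes "is_functor C set_cat T" "a \<in> Arr C"
  shows FArr_eq_act: "FArr T a = (FObj T (src C a), act T a, FObj T (tgt C a))"
    and act_PiE: "act T a \<in> FObj T (src C a) \<rightarrow>\<^sub>E FObj T (tgt C a)"
proof -
  obtain A f B where e: "FArr T a = (A, f, B)" by (cases "FArr T a") auto
  moreover have "act T a = f" using e by (simp add: act_def fun_eq_iff)
  ultimately show "FArr T a = (FObj T (src C a), act T a, FObj T (tgt C a))"
    "act T a \<in> FObj T (src C a) \<rightarrow>\<^sub>E FObj T (tgt C a)"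
    using functor_Arr[OF assms] functor_src[OF assms] functor_tgt[OF assms]
    by (auto simp: set_cat_def)
qed

lemma act_in:
  assumes "is_functor C set_cat T" "a \<in> Arr C" "v \<in> FObj T (src C a)"
  shows "act T a v \<in> FObj T (tgt C a)"
  using act_PiE[OF assms(1,2)] assms(3) by (auto simp: PiE_iff)

lemma act_ident:
  assumes "is_functor C set_cat T" "x \<in> Obj C" "v \<in> FObj T x"
  shows "act T (ident C x) v = v"
  using functor_ident[OF assms(1,2)] assms(3) by (simp add: act_def set_cat_def)

lemma act_cmp:
  assumes "is_functor C set_cat T" "a \<in> Arr C" "b \<in> Arr C" "src C a = tgt C b"
    and "v \<in> FObj T (src C b)"
  shows "act T (cmp C a b) v = act T a (act T b v)"
  using functor_cmp[OF assms(1-4)] assms(5)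
  by (simp add: act_def[of T "cmp C a b"] FArr_eq_act[OF assms(1,2)] FArr_eq_act[OF assms(1,3)]
      set_cat_def compose_eq)

text \<open>The converse passage, from fibres and maps to a functor. Each \<open>h a\<close> is cut
  down to the fibre because arrows of \<open>set_cat\<close> are extensional; \<open>h\<close>
  itself may take any values elsewhere.\<close>

definition set_functor ::
  "('x, 'g, 'z) cat_scheme \<Rightarrow> ('x \<Rightarrow> 'v set) \<Rightarrow> ('g \<Rightarrow> 'v \<Rightarrow> 'v) \<Rightarrow> ('x, 'g, 'v) set_functor" where
  "set_functor C X h = \<lparr>FObj = restrict X (Obj C),
     FArr = restrict (\<lambda>a. (X (src C a), restrict (h a) (X (src C a)), X (tgt C a))) (Arr C)\<rparr>"

lemma
  shows FObj_set_functor: "x \<in> Obj C \<Longrightarrow> FObj (set_functor C X h) x = X x"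
    and act_set_functor: "a \<in> Arr C \<Longrightarrow> v \<in> X (src C a) \<Longrightarrow> act (set_functor C X h) a v = h a v"
  by (simp_all add: set_functor_def act_def)

lemma is_functor_set_functor:
  assumes "category C"
    and "\<And>a v. a \<in> Arr C \<Longrightarrow> v \<in> X (src C a) \<Longrightarrow> h a v \<in> X (tgt C a)"
    and "\<And>x v. x \<in> Obj C \<Longrightarrow> v \<in> X x \<Longrightarrow> h (ident C x) v = v"
    and "\<And>a b v. a \<in> Arr C \<Longrightarrow> b \<in> Arr C \<Longrightarrow> src C a = tgt C b \<Longrightarrow> v \<in> X (src C b) \<Longrightarrow>
      h (cmp C a b) v = h a (h b v)"
  shows "is_functor C set_cat (set_functor C X h)"
  by (rule is_functorI)
    (auto simp: set_functor_def set_cat_def category_rules[OF assms(1)] assms(2-4)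
      fun_eq_iff compose_def)

section \<open>Groupoids of relation-preserving bijections\<close>

text \<open>The type \<open>'v sets\<close> is the one at which the universal property of the fundamental
  groupoid is available.\<close>

definition rel_groupoid :: "('v \<Rightarrow> 'v \<Rightarrow> bool) \<Rightarrow> 'v sets" where
  "rel_groupoid R = set_cat\<lparr>Arr := {(A, f, B). f \<in> A \<rightarrow>\<^sub>E B \<and> bij_betw f A B \<and>
     (\<forall>v\<in>A. \<forall>w\<in>A. R (f v) (f w) \<longleftrightarrow> R v w)}\<rparr>"

lemma rel_groupoid_simps:
  "Obj (rel_groupoid R) = UNIV"
  "(A, f, B) \<in> Arr (rel_groupoid R) \<longleftrightarrow> f \<in> A \<rightarrow>\<^sub>E B \<and> bij_betw f A B \<and>
     (\<forall>v\<in>A. \<forall>w\<in>A. R (f v) (f w) \<longleftrightarrow> R v w)"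
  "src (rel_groupoid R) (A, f, B) = A"
  "tgt (rel_groupoid R) (A, f, B) = B"
  "ident (rel_groupoid R) A = (A, restrict (\<lambda>v. v) A, A)"
  "cmp (rel_groupoid R) (B', g, C) (A, f, B) = (A, compose A g f, C)"
  by (simp_all add: rel_groupoid_def set_cat_def)

lemma category_rel_groupoid:
  fixes R :: "'v \<Rightarrow> 'v \<Rightarrow> bool"
  shows "category (rel_groupoid R)"
  unfolding category_def rel_groupoid_simps(1)
proof (intro conjI ballI impI UNIV_I)
  fix A :: "'v set"
  have "bij_betw (restrict (\<lambda>v. v) A) A A" by (simp add: bij_betw_def inj_on_def)
  then show "ident (rel_groupoid R) A \<in> Arr (rel_groupoid R)"
    by (simp add: rel_groupoid_simps)
next
  fix g f assume gf: "g \<in> Arr (rel_groupoid R)" "f \<in> Arr (rel_groupoid R)"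
    "src (rel_groupoid R) g = tgt (rel_groupoid R) f"
  obtain A B C f' g' where [simp]: "f = (A, f', B)" "g = (B, g', C)"
    using gf(3) by (cases f; cases g) (simp add: rel_groupoid_simps)
  have f: "bij_betw f' A B" "\<And>v. v \<in> A \<Longrightarrow> f' v \<in> B"
    and g: "bij_betw g' B C" "\<And>v. v \<in> B \<Longrightarrow> g' v \<in> C"
    using gf by (auto simp: rel_groupoid_simps)
  have "bij_betw (compose A g' f') A C"
    using f g by (simp add: bij_betw_compose)
  moreover have "compose A g' f' \<in> A \<rightarrow>\<^sub>E C"
    using f g by (simp add: PiE_iff compose_eq)
  ultimately show "cmp (rel_groupoid R) g f \<in> Arr (rel_groupoid R)"
    using gf f(2) by (simp add: rel_groupoid_simps compose_eq)
  show "src (rel_groupoid R) (cmp (rel_groupoid R) g f) = src (rel_groupoid R) f"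
    "tgt (rel_groupoid R) (cmp (rel_groupoid R) g f) = tgt (rel_groupoid R) g"
    by (simp_all add: rel_groupoid_simps)
next
  fix f assume "f \<in> Arr (rel_groupoid R)"
  then obtain A f' B where "f = (A, f', B)" "f' \<in> A \<rightarrow>\<^sub>E B"
    by (cases f) (simp add: rel_groupoid_simps)
  then show "cmp (rel_groupoid R) f (ident (rel_groupoid R) (src (rel_groupoid R) f)) = f"
    "cmp (rel_groupoid R) (ident (rel_groupoid R) (tgt (rel_groupoid R) f)) f = f"
    by (auto simp: rel_groupoid_simps compose_def fun_eq_iff PiE_iff extensional_def)
next
  fix h g f assume a: "h \<in> Arr (rel_groupoid R)" "g \<in> Arr (rel_groupoid R)"
    "f \<in> Arr (rel_groupoid R)"
    "src (rel_groupoid R) h = tgt (rel_groupoid R) g"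
    "src (rel_groupoid R) g = tgt (rel_groupoid R) f"
  obtain A f' B g' C h' D where "f = (A, f', B)" "g = (B, g', C)" "h = (C, h', D)"
    using a(4,5) by (cases f; cases g; cases h) (simp add: rel_groupoid_simps)
  then show "cmp (rel_groupoid R) h (cmp (rel_groupoid R) g f) =
      cmp (rel_groupoid R) (cmp (rel_groupoid R) h g) f"
    using a(3) by (auto simp: rel_groupoid_simps compose_def fun_eq_iff PiE_iff)
qed (simp_all add: rel_groupoid_simps)

text \<open>Arrows reflect \<open>R\<close> as well as preserve it, and this is what makes the
  inverse bijection an arrow again; preservation alone could be lost on inversion.\<close>

lemma groupoid_rel_groupoid: "groupoid (rel_groupoid R)"
  unfolding groupoid_def
proof (intro conjI ballI category_rel_groupoid)
  fix f assume "f \<in> Arr (rel_groupoid R)"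
  then obtain A f' B where [simp]: "f = (A, f', B)" and f: "f' \<in> A \<rightarrow>\<^sub>E B" "bij_betw f' A B"
    "\<And>v w. v \<in> A \<Longrightarrow> w \<in> A \<Longrightarrow> R (f' v) (f' w) \<longleftrightarrow> R v w"
    by (cases f) (simp add: rel_groupoid_simps)
  \<comment> \<open>\<open>inv_into\<close> also has values off \<open>B\<close>, where an arrow
    must be \<open>undefined\<close>.\<close>
  define g where "g = restrict (inv_into A f') B"
  have g: "bij_betw g B A" "g \<in> B \<rightarrow>\<^sub>E A"
    using bij_betw_inv_into[OF f(2)] by (auto simp: g_def bij_betw_def inj_on_def PiE_iff)
  have fg: "f' (g w) = w" "g w \<in> A" if "w \<in> B" for w
    using that bij_betw_inv_into_right[OF f(2)] g by (auto simp: g_def PiE_iff)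
  have gf: "g (f' v) = v" "f' v \<in> B" if "v \<in> A" for v
    using that bij_betw_inv_into_left[OF f(2)] f by (auto simp: g_def PiE_iff)
  have "\<forall>v\<in>B. \<forall>w\<in>B. R (g v) (g w) \<longleftrightarrow> R v w"
    using f(3) fg by metis
  then have "(B, g, A) \<in> Arr (rel_groupoid R)" using g by (simp add: rel_groupoid_simps)
  moreover have "compose A g f' = restrict (\<lambda>v. v) A" "compose B f' g = restrict (\<lambda>v. v) B"
    using fg gf by (auto simp: compose_def)
  ultimately show "is_iso (rel_groupoid R) f"
    using \<open>f \<in> Arr (rel_groupoid R)\<close> unfolding is_iso_def
    by (auto simp: rel_groupoid_simps(3-6) intro!: bexI[of _ "(B, g, A)"])
qed

text \<open>\<open>rel_groupoid R\<close> shares all its operations with \<open>set_cat\<close> and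
  differs only in which triples count as arrows, so the two notions of functor differ only by a
  condition on each \<open>act T a\<close>.\<close>

lemma is_functor_rel_groupoid_iff:
  "is_functor C (rel_groupoid R) T \<longleftrightarrow> is_functor C set_cat T \<and>
     (\<forall>a\<in>Arr C. bij_betw (act T a) (FObj T (src C a)) (FObj T (tgt C a)) \<and>
       (\<forall>v\<in>FObj T (src C a). \<forall>w\<in>FObj T (src C a). R (act T a v) (act T a w) \<longleftrightarrow> R v w))"
    (is "?L \<longleftrightarrow> ?R")
proof -
  have rel: "Obj (rel_groupoid R) = Obj set_cat" "src (rel_groupoid R) = src set_cat"
    "tgt (rel_groupoid R) = tgt set_cat" "ident (rel_groupoid R) = ident set_cat"
    "cmp (rel_groupoid R) = cmp set_cat"
    by (simp_all add: rel_groupoid_def)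
  have ?R if L: ?L
  proof -
    have "Arr C \<rightarrow>\<^sub>E Arr (rel_groupoid R) \<subseteq> Arr C \<rightarrow>\<^sub>E Arr set_cat"
      by (rule PiE_mono) (auto simp: rel_groupoid_def set_cat_def)
    then have s: "is_functor C set_cat T"
      using L unfolding is_functor_def rel by blast
    moreover have "FArr T a \<in> Arr (rel_groupoid R)" if "a \<in> Arr C" for a
      using functor_Arr[OF L that] .
    ultimately show ?R
      by (simp add: FArr_eq_act[OF s] rel_groupoid_def)
  qed
  moreover have ?L if R: ?R
  proof -
    have s: "is_functor C set_cat T" using R by blast
    have "FArr T a \<in> Arr (rel_groupoid R)" if "a \<in> Arr C" for a
      using that R act_PiE[OF s that] by (simp add: FArr_eq_act[OF s] rel_groupoid_def)
    then show ?L
      using s unfolding is_functor_def rel by (simp add: PiE_iff)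
  qed
  ultimately show ?thesis by blast
qed

text \<open>An inverse of \<open>a\<close> acts by the inverse map. Thus every set-valued functor on
  a groupoid lands in bijections, which brings the universal property, a statement about groupoids,
  to bear on functors into \<open>set_cat\<close>.\<close>

lemma bij_betw_act:
  assumes "groupoid G" "is_functor G set_cat T" "a \<in> Arr G"
  shows "bij_betw (act T a) (FObj T (src G a)) (FObj T (tgt G a))"
proof -
  have cat: "category G" using assms(1) by (simp add: groupoid_def)
  obtain b where b: "b \<in> Arr G" "src G b = tgt G a" "tgt G b = src G a"
    "cmp G b a = ident G (src G a)" "cmp G a b = ident G (tgt G a)"
    using assms(1,3) unfolding groupoid_def is_iso_def by blast
  have "act T b (act T a v) = v" if "v \<in> FObj T (src G a)" for v
    using act_cmp[OF assms(2) b(1) assms(3) b(2) that] b(4)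
      act_ident[OF assms(2) category_src[OF cat assms(3)] that] by simp
  moreover have "act T a (act T b v) = v" if "v \<in> FObj T (tgt G a)" for v
    using act_cmp[OF assms(2,3) b(1), of v] that b
      act_ident[OF assms(2) category_tgt[OF cat assms(3)] that] by simp
  ultimately show ?thesis
    using act_in[OF assms(2,3)] act_in[OF assms(2) b(1)] b(2,3)
    by (intro bij_betw_byWitness[where f' = "act T b"]) auto
qed

section \<open>Actions of the fundamental groupoid\<close>

lemma
  assumes "fundamental_groupoid t \<Lambda> G i"
  shows fundamental_groupoid_category: "category G"
    and fundamental_groupoid_Obj: "Obj G = Obj \<Lambda>"
    and fundamental_groupoid_functor: "is_functor \<Lambda> G i"
    and fundamental_groupoid_arr: "\<alpha> \<in> Arr \<Lambda> \<Longrightarrow> FArr i \<alpha> \<in> Arr G"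
    and fundamental_groupoid_FObj: "x \<in> Obj \<Lambda> \<Longrightarrow> FObj i x = x"
  using assms by (auto simp: fundamental_groupoid_def groupoid_def functor_rules)

lemma
  assumes "fundamental_groupoid t \<Lambda> G i" "category \<Lambda>" "\<alpha> \<in> Arr \<Lambda>"
  shows fundamental_groupoid_src: "src G (FArr i \<alpha>) = src \<Lambda> \<alpha>"
    and fundamental_groupoid_tgt: "tgt G (FArr i \<alpha>) = tgt \<Lambda> \<alpha>"
  using functor_src[OF fundamental_groupoid_functor[OF assms(1)] assms(3)]
    functor_tgt[OF fundamental_groupoid_functor[OF assms(1)] assms(3)]
    category_src[OF assms(2,3)] category_tgt[OF assms(2,3)]
    fundamental_groupoid_FObj[OF assms(1)] by simp_all

section \<open>Extending and comparing set-valued functors along \<open>i\<close>\<close>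

lemma set_functor_eqI:
  assumes "is_functor C set_cat T" "is_functor C set_cat T'" "category C"
    and "\<And>x. x \<in> Obj C \<Longrightarrow> FObj T x = FObj T' x"
    and "\<And>a v. a \<in> Arr C \<Longrightarrow> v \<in> FObj T (src C a) \<Longrightarrow> act T a v = act T' a v"
  shows "T = T'"
proof (rule functor_eqI[OF assms(1,2,4)])
  fix a assume a: "a \<in> Arr C"
  have o: "FObj T (src C a) = FObj T' (src C a)" "FObj T (tgt C a) = FObj T' (tgt C a)"
    using a assms(3,4) by (auto simp: category_rules)
  have "act T a = act T' a"
    using act_PiE[OF assms(1) a] act_PiE[OF assms(2) a] assms(5)[OF a] o by (auto intro: PiE_ext)
  then show "FArr T a = FArr T' a"
    using o by (simp add: FArr_eq_act[OF assms(1) a] FArr_eq_act[OF assms(2) a])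
qed

lemma act_fcomp: "\<alpha> \<in> Arr \<Lambda> \<Longrightarrow> act (fcomp \<Lambda> T i) \<alpha> = act T (FArr i \<alpha>)"
  by (simp add: act_def fctr_simps fun_eq_iff)

text \<open>The existence half of the universal property at \<open>rel_groupoid R\<close>, restated
  through fibres and actions. Fibres are kept because \<open>i\<close> fixes the objects.\<close>

lemma set_functor_extension:
  fixes F :: "('x, 'a, 'v) set_functor" and \<Lambda> :: "('x, 'a) kgraph"
  assumes fg: "fundamental_groupoid TYPE('v sets) \<Lambda> G i"
    and F: "is_functor \<Lambda> (rel_groupoid R) F"
  obtains T where "is_functor G (rel_groupoid R) T"
    and "\<And>x. x \<in> Obj G \<Longrightarrow> FObj T x = FObj F x"
    and "\<And>\<alpha> v. \<alpha> \<in> Arr \<Lambda> \<Longrightarrow> act T (FArr i \<alpha>) v = act F \<alpha> v"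
proof -
  obtain T where T: "is_functor G (rel_groupoid R) T" "fcomp \<Lambda> T i = F"
    using fg F groupoid_rel_groupoid unfolding fundamental_groupoid_def by blast
  show thesis
  proof (rule that[OF T(1)])
    fix x assume "x \<in> Obj G"
    then show "FObj T x = FObj F x"
      using FObj_fcomp[of x \<Lambda> T i] T(2) fundamental_groupoid_Obj[OF fg]
        fundamental_groupoid_FObj[OF fg] by simp
  next
    fix \<alpha> v assume "\<alpha> \<in> Arr \<Lambda>"
    then show "act T (FArr i \<alpha>) v = act F \<alpha> v" using act_fcomp T(2) by metis
  qed
qed

text \<open>The uniqueness half of the universal property. For \<open>R\<close> constantly true,
  \<open>bij_betw_act\<close> places both functors in \<open>rel_groupoid R\<close>, and the
  hypotheses say that they restrict to the same functor on \<open>\<Lambda>\<close>.\<close>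

lemma set_functor_determined:
  fixes T S :: "('x, 'g, 'v) set_functor" and \<Lambda> :: "('x, 'a) kgraph"
  assumes fg: "fundamental_groupoid TYPE('v sets) \<Lambda> G i" and cat: "category \<Lambda>"
    and T: "is_functor G set_cat T" and S: "is_functor G set_cat S"
    and obj: "\<And>x. x \<in> Obj G \<Longrightarrow> FObj T x = FObj S x"
    and arr: "\<And>\<alpha> v. \<alpha> \<in> Arr \<Lambda> \<Longrightarrow> v \<in> FObj T (src \<Lambda> \<alpha>) \<Longrightarrow>
      act T (FArr i \<alpha>) v = act S (FArr i \<alpha>) v"
  shows "T = S"
proof -
  have gG: "groupoid G" using fg by (simp add: fundamental_groupoid_def)
  note i = fundamental_groupoid_functor[OF fg]
  have rel: "is_functor G (rel_groupoid (\<lambda>_ _. True)) U" if "is_functor G set_cat U"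
    for U :: "('x, 'g, 'v) set_functor"
    using that bij_betw_act[OF gG that] by (simp add: is_functor_rel_groupoid_iff)
  have "fcomp \<Lambda> T i = fcomp \<Lambda> S i"
  proof (rule set_functor_eqI[OF is_functor_fcomp[OF cat i T] is_functor_fcomp[OF cat i S] cat])
    show "FObj (fcomp \<Lambda> T i) x = FObj (fcomp \<Lambda> S i) x" if "x \<in> Obj \<Lambda>" for x
      using that obj functor_Obj[OF i] by (simp add: fctr_simps)
    show "act (fcomp \<Lambda> T i) \<alpha> v = act (fcomp \<Lambda> S i) \<alpha> v"
      if "\<alpha> \<in> Arr \<Lambda>" "v \<in> FObj (fcomp \<Lambda> T i) (src \<Lambda> \<alpha>)" for \<alpha> v
      using that arr category_src[OF cat]
      by (simp add: act_fcomp fctr_simps fundamental_groupoid_FObj[OF fg])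
  qed
  moreover have "\<exists>!F'. is_functor G (rel_groupoid (\<lambda>_ _. True)) F' \<and> fcomp \<Lambda> F' i = fcomp \<Lambda> S i"
    using fg groupoid_rel_groupoid is_functor_fcomp[OF cat i rel[OF S]]
    unfolding fundamental_groupoid_def by blast
  ultimately show ?thesis using rel[OF T] rel[OF S] by blast
qed

text \<open>This replaces the fact that \<open>G\<close> is generated by the image of \<open>i\<close>, which is out of reach:
  \<open>G\<close> need not embed in the type \<open>'v sets\<close>. Instead, the universal property at the groupoid of
  \<open>R\<close>-preserving bijections extends the restriction of \<open>T\<close> to \<open>\<Lambda>\<close>, and uniqueness in the groupoid
  of all bijections identifies the extension with \<open>T\<close>.\<close>

lemma act_preserves_relation:
  fixes T :: "('x, 'g, 'v) set_functor" and \<Lambda> :: "('x, 'a) kgraph"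
  assumes fg: "fundamental_groupoid TYPE('v sets) \<Lambda> G i" and cat: "category \<Lambda>"
    and T: "is_functor G set_cat T"
    and R: "\<And>\<alpha> v w. \<alpha> \<in> Arr \<Lambda> \<Longrightarrow> v \<in> FObj T (src \<Lambda> \<alpha>) \<Longrightarrow> w \<in> FObj T (src \<Lambda> \<alpha>) \<Longrightarrow>
      R (act T (FArr i \<alpha>) v) (act T (FArr i \<alpha>) w) \<longleftrightarrow> R v w"
    and a: "a \<in> Arr G" "v \<in> FObj T (src G a)" "w \<in> FObj T (src G a)"
  shows "R (act T a v) (act T a w) \<longleftrightarrow> R v w"
proof -
  have gG: "groupoid G" using fg by (simp add: fundamental_groupoid_def)
  note i = fundamental_groupoid_functor[OF fg]
  have o: "FObj (fcomp \<Lambda> T i) x = FObj T x" if "x \<in> Obj \<Lambda>" for x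
    using that by (simp add: fctr_simps fundamental_groupoid_FObj[OF fg])
  have "bij_betw (act (fcomp \<Lambda> T i) \<alpha>) (FObj (fcomp \<Lambda> T i) (src \<Lambda> \<alpha>))
      (FObj (fcomp \<Lambda> T i) (tgt \<Lambda> \<alpha>))" if "\<alpha> \<in> Arr \<Lambda>" for \<alpha>
    using bij_betw_act[OF gG T fundamental_groupoid_arr[OF fg that]]
    by (simp add: that act_fcomp o category_src[OF cat] category_tgt[OF cat]
        fundamental_groupoid_src[OF fg cat] fundamental_groupoid_tgt[OF fg cat])
  then have "is_functor \<Lambda> (rel_groupoid R) (fcomp \<Lambda> T i)"
    using R category_src[OF cat]
    by (simp add: is_functor_rel_groupoid_iff is_functor_fcomp[OF cat i T] act_fcomp o)
  then obtain T' where T': "is_functor G (rel_groupoid R) T'"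
    "\<And>x. x \<in> Obj G \<Longrightarrow> FObj T' x = FObj (fcomp \<Lambda> T i) x"
    "\<And>\<alpha> v. \<alpha> \<in> Arr \<Lambda> \<Longrightarrow> act T' (FArr i \<alpha>) v = act (fcomp \<Lambda> T i) \<alpha> v"
    using set_functor_extension[OF fg] by metis
  have "T = T'"
    using T'(2,3) o fundamental_groupoid_Obj[OF fg] T'(1)
    by (intro set_functor_determined[OF fg cat T])
      (auto simp: is_functor_rel_groupoid_iff act_fcomp)
  then show ?thesis using T'(1) a by (simp add: is_functor_rel_groupoid_iff)
qed

section \<open>Equivariance: from the morphisms of \<open>\<Lambda>\<close> to all of
  \<open>G\<close>\<close>

lemma
  assumes "action G V T"
  shows action_functor: "is_functor G set_cat T"
    and action_in: "x \<in> Obj G \<Longrightarrow> v \<in> FObj T x \<Longrightarrow> v \<in> V"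
    and action_fibre: "v \<in> V \<Longrightarrow> \<exists>x\<in>Obj G. v \<in> FObj T x"
    and action_disjoint:
      "x \<in> Obj G \<Longrightarrow> y \<in> Obj G \<Longrightarrow> v \<in> FObj T x \<Longrightarrow> v \<in> FObj T y \<Longrightarrow> x = y"
  using assms unfolding action_def by auto

lemma action_morphismI:
  fixes T S :: "('x, 'g, 'v) set_functor" and \<Lambda> :: "('x, 'a) kgraph"
  assumes fg: "fundamental_groupoid TYPE('v sets) \<Lambda> G i" and cat: "category \<Lambda>"
    and T: "action G V T" and S: "action G U S" and \<phi>: "\<phi> \<in> V \<rightarrow>\<^sub>E U"
    and fib: "\<And>x v. x \<in> Obj G \<Longrightarrow> v \<in> FObj T x \<Longrightarrow> \<phi> v \<in> FObj S x"
    and eqv: "\<And>\<alpha> v. \<alpha> \<in> Arr \<Lambda> \<Longrightarrow> v \<in> FObj T (src \<Lambda> \<alpha>) \<Longrightarrow>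
      \<phi> (act T (FArr i \<alpha>) v) = act S (FArr i \<alpha>) (\<phi> v)"
  shows "action_morphism G V T U S \<phi>"
proof -
  note G = fundamental_groupoid_category[OF fg]
  note oG = fundamental_groupoid_Obj[OF fg]
  note iG = fundamental_groupoid_arr[OF fg] fundamental_groupoid_src[OF fg cat]
    fundamental_groupoid_tgt[OF fg cat]
  note fT = action_functor[OF T] and fS = action_functor[OF S]
  have gG: "groupoid G" using fg by (simp add: fundamental_groupoid_def)
  \<comment> \<open>A preimage of \<open>b\<close> lies over some vertex, and \<open>\<phi>\<close>
    respects fibres; since the fibres of \<open>S\<close> are disjoint, that vertex can only be
    \<open>x\<close>.\<close>
  have range: "\<exists>v\<in>FObj T x. b = \<phi> v" if x: "x \<in> Obj G" and "b \<in> FObj S x" "b \<in> \<phi> ` V" for b x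
    using that action_fibre[OF T] action_disjoint[OF S x] fib by blast
  have bS: "bij_betw (act S (FArr i \<alpha>)) (FObj S (src \<Lambda> \<alpha>)) (FObj S (tgt \<Lambda> \<alpha>))"
    and bT: "bij_betw (act T (FArr i \<alpha>)) (FObj T (src \<Lambda> \<alpha>)) (FObj T (tgt \<Lambda> \<alpha>))"
    and o: "src \<Lambda> \<alpha> \<in> Obj G" "tgt \<Lambda> \<alpha> \<in> Obj G" if "\<alpha> \<in> Arr \<Lambda>" for \<alpha>
    using bij_betw_act[OF gG fS iG(1)[OF that]] bij_betw_act[OF gG fT iG(1)[OF that]]
      iG(2,3)[OF that] oG category_src[OF cat that] category_tgt[OF cat that] by simp_all
  have iS: "act S (FArr i \<alpha>) b = act S (FArr i \<alpha>) c \<longleftrightarrow> b = c"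
    if "\<alpha> \<in> Arr \<Lambda>" "b \<in> FObj S (src \<Lambda> \<alpha>)" "c \<in> FObj S (src \<Lambda> \<alpha>)" for \<alpha> b c
    using inj_on_eq_iff[OF bij_betw_imp_inj_on[OF bS[OF that(1)]] that(2,3)] .
  \<comment> \<open>The relation is equality of \<open>\<phi>\<close>-values. Along
    \<open>\<Lambda>\<close> it is preserved by equivariance and reflected because \<open>S\<close>
    acts injectively on each fibre.\<close>
  have ker: "\<phi> (act T a v) = \<phi> (act T a w) \<longleftrightarrow> \<phi> v = \<phi> w"
    if "a \<in> Arr G" "v \<in> FObj T (src G a)" "w \<in> FObj T (src G a)" for a v w
  proof (rule act_preserves_relation[OF fg cat fT _ that])
    fix \<alpha> v w assume "\<alpha> \<in> Arr \<Lambda>" "v \<in> FObj T (src \<Lambda> \<alpha>)" "w \<in> FObj T (src \<Lambda> \<alpha>)"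
    then show "\<phi> (act T (FArr i \<alpha>) v) = \<phi> (act T (FArr i \<alpha>) w) \<longleftrightarrow> \<phi> v = \<phi> w"
      using iS fib[OF o(1)] by (simp add: eqv)
  qed
  \<comment> \<open>Membership in the range is a unary condition, treated as a relation that ignores
    one argument; the point \<open>b\<close> is therefore supplied twice.\<close>
  have im: "act S a b \<in> \<phi> ` V \<longleftrightarrow> b \<in> \<phi> ` V" if "a \<in> Arr G" "b \<in> FObj S (src G a)" for a b
  proof (rule act_preserves_relation[OF fg cat fS _ that that(2)])
    fix \<alpha> b assume a: "\<alpha> \<in> Arr \<Lambda>" and b: "b \<in> FObj S (src \<Lambda> \<alpha>)"
    show "act S (FArr i \<alpha>) b \<in> \<phi> ` V \<longleftrightarrow> b \<in> \<phi> ` V"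
    proof
      assume "b \<in> \<phi> ` V"
      then obtain v where v: "v \<in> FObj T (src \<Lambda> \<alpha>)" "b = \<phi> v"
        using range o(1)[OF a] b by blast
      then have "act S (FArr i \<alpha>) b = \<phi> (act T (FArr i \<alpha>) v)" using eqv[OF a] by simp
      moreover have "act T (FArr i \<alpha>) v \<in> V"
        using action_in[OF T o(2)[OF a]] v(1) bT[OF a] by (auto simp: bij_betw_def)
      ultimately show "act S (FArr i \<alpha>) b \<in> \<phi> ` V" by blast
    next
      assume "act S (FArr i \<alpha>) b \<in> \<phi> ` V"
      moreover have "act S (FArr i \<alpha>) b \<in> FObj S (tgt \<Lambda> \<alpha>)"
        using bS[OF a] b by (auto simp: bij_betw_def)
      ultimately obtain w where w: "w \<in> FObj T (tgt \<Lambda> \<alpha>)" "act S (FArr i \<alpha>) b = \<phi> w"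
        using range o(2)[OF a] by blast
      \<comment> \<open>\<open>T\<close> acts surjectively from fibre to fibre, so the preimage
        \<open>w\<close> can be pulled back along \<open>\<alpha>\<close>; injectivity of
        \<open>S\<close> then identifies \<open>b\<close> with the image of the pulled-back
        point.\<close>
      obtain v where v: "v \<in> FObj T (src \<Lambda> \<alpha>)" "w = act T (FArr i \<alpha>) v"
        using w(1) bT[OF a] by (auto simp: bij_betw_def)
      have "act S (FArr i \<alpha>) b = act S (FArr i \<alpha>) (\<phi> v)" using w v eqv[OF a] by simp
      then have "b = \<phi> v" using iS[OF a b fib[OF o(1)[OF a] v(1)]] by simp
      then show "b \<in> \<phi> ` V" using action_in[OF T o(1)[OF a] v(1)] by blast
    qed
  qed
  text \<open>\<open>S'\<close> is the action on \<open>U\<close> for which \<open>\<phi>\<close> is equivariant by construction. It agrees with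
    \<open>S\<close> on \<open>\<Lambda>\<close>, hence everywhere.\<close>
  define h where "h = (\<lambda>a b. if b \<in> \<phi> ` V then \<phi> (act T a (inv_into V \<phi> b)) else act S a b)"
  define S' where "S' = set_functor G (FObj S) h"
  \<comment> \<open>\<open>inv_into\<close> picks some preimage of \<open>\<phi> v\<close>, perhaps
    not \<open>v\<close>. It lies in the same fibre of \<open>T\<close> because the fibres of
    \<open>S\<close> are disjoint, and by \<open>ker\<close> the choice does not affect the
    value.\<close>
  have h1: "h a (\<phi> v) = \<phi> (act T a v)" if a: "a \<in> Arr G" and v: "v \<in> FObj T (src G a)" for a v
  proof -
    have sa: "src G a \<in> Obj G" using category_src[OF G a] .
    let ?w = "inv_into V \<phi> (\<phi> v)"
    have vV: "\<phi> v \<in> \<phi> ` V" using action_in[OF T sa v] by blast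
    have w: "?w \<in> V" "\<phi> ?w = \<phi> v" using inv_into_into[OF vV] f_inv_into_f[OF vV] by auto
    obtain y where y: "y \<in> Obj G" "?w \<in> FObj T y" using action_fibre[OF T w(1)] by blast
    have "y = src G a"
      using action_disjoint[OF S y(1) sa, of "\<phi> v"] fib[OF y] fib[OF sa v] w(2) by simp
    then show ?thesis using ker[OF a] y v w(2) vV by (simp add: h_def)
  qed
  have h2: "h a b = act S a b" if "b \<notin> \<phi> ` V" for a b using that by (simp add: h_def)
  have S': "is_functor G set_cat S'"
    unfolding S'_def
  proof (rule is_functor_set_functor[OF G])
    fix a b assume a: "a \<in> Arr G" and b: "b \<in> FObj S (src G a)"
    show "h a b \<in> FObj S (tgt G a)"
    proof (cases "b \<in> \<phi> ` V")
      case True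
      then obtain v where "v \<in> FObj T (src G a)" "b = \<phi> v"
        using range[OF category_src[OF G a] b] by blast
      then show ?thesis using h1[OF a] act_in[OF fT a] fib[OF category_tgt[OF G a]] by simp
    qed (simp add: h2 act_in[OF fS a b])
  next
    fix x b assume x: "x \<in> Obj G" and b: "b \<in> FObj S x"
    show "h (ident G x) b = b"
    proof (cases "b \<in> \<phi> ` V")
      case True
      then obtain v where "v \<in> FObj T x" "b = \<phi> v" using range[OF x b] by blast
      then show ?thesis
        using h1[OF category_ident[OF G x]] category_src_ident[OF G x] act_ident[OF fT x] by simp
    qed (simp add: h2 act_ident[OF fS x b])
  next
    fix a c b assume ac: "a \<in> Arr G" "c \<in> Arr G" "src G a = tgt G c" and b: "b \<in> FObj S (src G c)"
    show "h (cmp G a c) b = h a (h c b)"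
    proof (cases "b \<in> \<phi> ` V")
      case True
      then obtain v where "v \<in> FObj T (src G c)" "b = \<phi> v"
        using range[OF category_src[OF G ac(2)] b] by blast
      then show ?thesis
        using h1[OF category_cmp[OF G ac]] h1[OF ac(1)] h1[OF ac(2)] act_in[OF fT ac(2)] ac(3)
          category_src_cmp[OF G ac] act_cmp[OF fT ac] by simp
    next
      \<comment> \<open>By \<open>im\<close>, acting with \<open>c\<close> keeps a point outside the
        range, so both steps of \<open>h\<close> follow \<open>S\<close> and never switch to the
        other branch.\<close>
      case False
      then show ?thesis using im[OF ac(2) b] by (simp add: h2 act_cmp[OF fS ac b])
    qed
  qed
  have "S = S'"
  proof (rule set_functor_determined[OF fg cat fS S'])
    show "FObj S x = FObj S' x" if "x \<in> Obj G" for x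
      using that by (simp add: S'_def FObj_set_functor)
    fix \<alpha> b assume a: "\<alpha> \<in> Arr \<Lambda>" and b: "b \<in> FObj S (src \<Lambda> \<alpha>)"
    have "h (FArr i \<alpha>) b = act S (FArr i \<alpha>) b"
    proof (cases "b \<in> \<phi> ` V")
      case True
      then obtain v where "v \<in> FObj T (src \<Lambda> \<alpha>)" "b = \<phi> v" using range[OF o(1)[OF a] b] by blast
      then show ?thesis using h1[OF iG(1)[OF a]] iG(2)[OF a] eqv[OF a] by simp
    qed (simp add: h2)
    then show "act S (FArr i \<alpha>) b = act S' (FArr i \<alpha>) b"
      using iG[OF a] b by (simp add: S'_def act_set_functor)
  qed
  then have "act S a b = h a b" if "a \<in> Arr G" "b \<in> FObj S (src G a)" for a b
    using that act_set_functor[of a G b "FObj S" h] by (simp add: S'_def)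
  then have "\<phi> (act T a v) = act S a (\<phi> v)" if "a \<in> Arr G" "v \<in> FObj T (src G a)" for a v
    using that h1 fib[OF category_src[OF G]] by simp
  then show ?thesis
    using \<phi> fib by (auto simp: action_morphism_def)
qed

section \<open>The categories of coverings and of actions\<close>

lemma categoryI:
  assumes "\<And>f. f \<in> Arr C \<Longrightarrow> src C f \<in> Obj C \<and> tgt C f \<in> Obj C"
    and "\<And>x. x \<in> Obj C \<Longrightarrow> ident C x \<in> Arr C \<and> src C (ident C x) = x \<and> tgt C (ident C x) = x"
    and "\<And>g f. g \<in> Arr C \<Longrightarrow> f \<in> Arr C \<Longrightarrow> src C g = tgt C f \<Longrightarrow>
      cmp C g f \<in> Arr C \<and> src C (cmp C g f) = src C f \<and> tgt C (cmp C g f) = tgt C g"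
    and "\<And>f. f \<in> Arr C \<Longrightarrow> cmp C f (ident C (src C f)) = f \<and> cmp C (ident C (tgt C f)) f = f"
    and "\<And>h g f. h \<in> Arr C \<Longrightarrow> g \<in> Arr C \<Longrightarrow> f \<in> Arr C \<Longrightarrow> src C h = tgt C g \<Longrightarrow>
      src C g = tgt C f \<Longrightarrow> cmp C h (cmp C g f) = cmp C (cmp C h g) f"
  shows "category C"
  using assms unfolding category_def by blast

lemma covering_cat_simps:
  "(\<Omega>, p) \<in> Obj (covering_cat k \<Lambda>) \<longleftrightarrow> covering k \<Lambda> \<Omega> p"
  "((\<Omega>, p), \<phi>, (\<Sigma>, q)) \<in> Arr (covering_cat k \<Lambda>) \<longleftrightarrow>
     covering k \<Lambda> \<Omega> p \<and> covering k \<Lambda> \<Sigma> q \<and> covering_morphism \<Omega> p \<Sigma> q \<phi>"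
  "src (covering_cat k \<Lambda>) (X, \<phi>, Y) = X"
  "tgt (covering_cat k \<Lambda>) (X, \<phi>, Y) = Y"
  "ident (covering_cat k \<Lambda>) (\<Omega>, p) = ((\<Omega>, p), fid \<Omega>, (\<Omega>, p))"
  "cmp (covering_cat k \<Lambda>) (Y', \<psi>, Z) (X, \<phi>, Y) = (X, fcomp (fst X) \<psi> \<phi>, Z)"
  by (simp_all add: covering_cat_def)

lemma action_cat_simps:
  "(V, T) \<in> Obj (action_cat G) \<longleftrightarrow> action G V T \<and> fibres_nonempty G T"
  "((V, T), \<phi>, (U, S)) \<in> Arr (action_cat G) \<longleftrightarrow> action G V T \<and> fibres_nonempty G T \<and>
     action G U S \<and> fibres_nonempty G S \<and> action_morphism G V T U S \<phi>"
  "src (action_cat G) (X, \<phi>, Y) = X"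
  "tgt (action_cat G) (X, \<phi>, Y) = Y"
  "ident (action_cat G) (V, T) = ((V, T), restrict (\<lambda>v. v) V, (V, T))"
  "cmp (action_cat G) (Y', \<psi>, Z) (X, \<phi>, Y) = (X, compose (fst X) \<psi> \<phi>, Z)"
  by (simp_all add: action_cat_def)

lemma
  assumes "covering k \<Lambda> \<Omega> p"
  shows covering_category: "category \<Omega>"
    and covering_functor: "is_functor \<Omega> \<Lambda> p"
    and covering_deg: "\<mu> \<in> Arr \<Omega> \<Longrightarrow> deg \<Lambda> (FArr p \<mu>) = deg \<Omega> \<mu>"
    and covering_surj: "FObj p ` Obj \<Omega> = Obj \<Lambda>"
    and covering_bij_from:
      "v \<in> Obj \<Omega> \<Longrightarrow> bij_betw (FArr p) (arrows_from \<Omega> v) (arrows_from \<Lambda> (FObj p v))"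
    and covering_bij_to:
      "v \<in> Obj \<Omega> \<Longrightarrow> bij_betw (FArr p) (arrows_to \<Omega> v) (arrows_to \<Lambda> (FObj p v))"
  using assms by (auto simp: covering_def k_graph_def kgraph_morphism_def)

lemma covering_morphism_functor: "covering_morphism \<Omega> p \<Sigma> q \<phi> \<Longrightarrow> is_functor \<Omega> \<Sigma> \<phi>"
  by (simp add: covering_morphism_def kgraph_morphism_def)

lemma
  assumes "covering_morphism \<Omega> p \<Sigma> q \<phi>"
  shows covering_morphism_FObj: "v \<in> Obj \<Omega> \<Longrightarrow> FObj q (FObj \<phi> v) = FObj p v"
    and covering_morphism_FArr: "\<mu> \<in> Arr \<Omega> \<Longrightarrow> FArr q (FArr \<phi> \<mu>) = FArr p \<mu>"
  using assms FObj_fcomp[of v \<Omega> q \<phi>] FArr_fcomp[of \<mu> \<Omega> q \<phi>]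
  by (simp_all add: covering_morphism_def)

text \<open>Degrees need no separate check: \<open>p\<close> and \<open>q\<close> preserve them, and
  \<open>q\<close> after \<open>\<phi>\<close> is \<open>p\<close>.\<close>

lemma covering_morphismI:
  assumes p: "covering k \<Lambda> \<Omega> p" and q: "covering k \<Lambda> \<Sigma> q" and \<phi>: "is_functor \<Omega> \<Sigma> \<phi>"
    and o: "\<And>v. v \<in> Obj \<Omega> \<Longrightarrow> FObj q (FObj \<phi> v) = FObj p v"
    and a: "\<And>\<mu>. \<mu> \<in> Arr \<Omega> \<Longrightarrow> FArr q (FArr \<phi> \<mu>) = FArr p \<mu>"
  shows "covering_morphism \<Omega> p \<Sigma> q \<phi>"
proof -
  have "fcomp \<Omega> q \<phi> = p"
    by (rule functor_eqI[OF is_functor_fcomp[OF covering_category[OF p] \<phi> covering_functor[OF q]]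
          covering_functor[OF p]]) (simp_all add: fctr_simps o a)
  moreover have "deg \<Sigma> (FArr \<phi> \<mu>) = deg \<Omega> \<mu>" if "\<mu> \<in> Arr \<Omega>" for \<mu>
    using covering_deg[OF q functor_Arr[OF \<phi> that]] covering_deg[OF p that] a[OF that] by simp
  ultimately show ?thesis using \<phi> by (simp add: covering_morphism_def kgraph_morphism_def)
qed

lemma category_covering_cat:
  fixes \<Lambda> :: "('x, 'a) kgraph"
  shows "category (covering_cat k \<Lambda> :: (('x, 'a, 'v) cov, ('x, 'a, 'v) cov_arrow) cat)"
    (is "category ?C")
proof (rule categoryI)
  fix f assume f: "f \<in> Arr ?C"
  obtain \<Omega> p \<phi> \<Sigma> q where [simp]: "f = ((\<Omega>, p), \<phi>, (\<Sigma>, q))" by (metis prod.exhaust)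
  show "src ?C f \<in> Obj ?C \<and> tgt ?C f \<in> Obj ?C" using f by (simp add: covering_cat_simps)
  have c: "category \<Omega>" "category \<Sigma>" "is_functor \<Omega> \<Sigma> \<phi>"
    using f by (auto simp: covering_cat_simps intro: covering_category covering_morphism_functor)
  show "cmp ?C f (ident ?C (src ?C f)) = f \<and> cmp ?C (ident ?C (tgt ?C f)) f = f"
    using fcomp_fid[OF c(1,3)] fid_fcomp[OF c] by (simp add: covering_cat_simps)
next
  fix x assume x: "x \<in> Obj ?C"
  obtain \<Omega> p where [simp]: "x = (\<Omega>, p)" by (cases x)
  have p: "covering k \<Lambda> \<Omega> p" using x by (simp add: covering_cat_simps)
  show "ident ?C x \<in> Arr ?C \<and> src ?C (ident ?C x) = x \<and> tgt ?C (ident ?C x) = x"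
    by (simp add: covering_cat_simps p fctr_simps
        covering_morphismI[OF p p is_functor_fid[OF covering_category[OF p]]])
next
  fix g f assume gf: "g \<in> Arr ?C" "f \<in> Arr ?C" "src ?C g = tgt ?C f"
  obtain \<Omega> p \<phi> \<Sigma> q \<psi> \<Theta> t where [simp]: "f = ((\<Omega>, p), \<phi>, (\<Sigma>, q))" "g = ((\<Sigma>, q), \<psi>, (\<Theta>, t))"
    using gf(3) by (cases f; cases g) (auto simp: covering_cat_simps)
  have c: "covering k \<Lambda> \<Omega> p" "covering k \<Lambda> \<Sigma> q" "covering k \<Lambda> \<Theta> t"
    "covering_morphism \<Omega> p \<Sigma> q \<phi>" "covering_morphism \<Sigma> q \<Theta> t \<psi>"
    using gf by (simp_all add: covering_cat_simps)
  note \<phi> = covering_morphism_functor[OF c(4)]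
  have "covering_morphism \<Omega> p \<Theta> t (fcomp \<Omega> \<psi> \<phi>)"
    by (rule covering_morphismI[OF c(1,3)
          is_functor_fcomp[OF covering_category[OF c(1)] \<phi> covering_morphism_functor[OF c(5)]]])
      (simp_all add: fctr_simps functor_rules[OF \<phi>] covering_morphism_FObj[OF c(5)]
        covering_morphism_FArr[OF c(5)] covering_morphism_FObj[OF c(4)]
        covering_morphism_FArr[OF c(4)])
  then show "cmp ?C g f \<in> Arr ?C \<and> src ?C (cmp ?C g f) = src ?C f \<and>
      tgt ?C (cmp ?C g f) = tgt ?C g"
    using c by (simp add: covering_cat_simps)
next
  fix h g f assume hgf: "h \<in> Arr ?C" "g \<in> Arr ?C" "f \<in> Arr ?C"
    "src ?C h = tgt ?C g" "src ?C g = tgt ?C f"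
  obtain \<Omega> p \<phi> \<Sigma> q \<psi> \<Theta> t \<chi> \<Xi> u where [simp]: "f = ((\<Omega>, p), \<phi>, (\<Sigma>, q))"
    "g = ((\<Sigma>, q), \<psi>, (\<Theta>, t))" "h = ((\<Theta>, t), \<chi>, (\<Xi>, u))"
    using hgf(4,5) by (cases f; cases g; cases h) (auto simp: covering_cat_simps)
  have c: "category \<Omega>" "category \<Sigma>" "is_functor \<Omega> \<Sigma> \<phi>" "is_functor \<Sigma> \<Theta> \<psi>" "is_functor \<Theta> \<Xi> \<chi>"
    using hgf(1-3)
    by (auto simp: covering_cat_simps intro: covering_category covering_morphism_functor)
  show "cmp ?C h (cmp ?C g f) = cmp ?C (cmp ?C h g) f"
    using fcomp_assoc[OF c] by (simp add: covering_cat_simps)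
qed

lemma category_action_cat:
  fixes G :: "('x, 'g) cat"
  assumes G: "category G"
  shows "category (action_cat G :: (('x, 'g, 'v) actn, ('x, 'g, 'v) actn_arrow) cat)"
    (is "category ?C")
proof (rule categoryI)
  fix f assume f: "f \<in> Arr ?C"
  obtain V T \<phi> U S where [simp]: "f = ((V, T), \<phi>, (U, S))" by (metis prod.exhaust)
  have "\<phi> \<in> V \<rightarrow>\<^sub>E U" using f by (simp add: action_cat_simps action_morphism_def)
  then have "compose V \<phi> (restrict (\<lambda>v. v) V) = \<phi>" "compose V (restrict (\<lambda>v. v) U) \<phi> = \<phi>"
    by (auto simp: compose_def fun_eq_iff PiE_iff extensional_def)
  then show "cmp ?C f (ident ?C (src ?C f)) = f \<and> cmp ?C (ident ?C (tgt ?C f)) f = f"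
    by (simp add: action_cat_simps)
  show "src ?C f \<in> Obj ?C \<and> tgt ?C f \<in> Obj ?C" using f by (simp add: action_cat_simps)
next
  fix x assume x: "x \<in> Obj ?C"
  obtain V T where [simp]: "x = (V, T)" by (cases x)
  have T: "action G V T" using x by (simp add: action_cat_simps)
  have "act T a v \<in> V" "v \<in> V" if "a \<in> Arr G" "v \<in> FObj T (src G a)" for a v
    using that action_in[OF T category_tgt[OF G that(1)]]
      action_in[OF T category_src[OF G that(1)]] act_in[OF action_functor[OF T]] by auto
  then have "action_morphism G V T V T (restrict (\<lambda>v. v) V)"
    using action_in[OF T] by (auto simp: action_morphism_def)
  then show "ident ?C x \<in> Arr ?C \<and> src ?C (ident ?C x) = x \<and> tgt ?C (ident ?C x) = x"
    using x by (simp add: action_cat_simps)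
next
  fix g f assume gf: "g \<in> Arr ?C" "f \<in> Arr ?C" "src ?C g = tgt ?C f"
  obtain V T \<phi> U S \<psi> W R where [simp]: "f = ((V, T), \<phi>, (U, S))" "g = ((U, S), \<psi>, (W, R))"
    using gf(3) by (cases f; cases g) (auto simp: action_cat_simps)
  have T: "action G V T" and m: "action_morphism G V T U S \<phi>" "action_morphism G U S W R \<psi>"
    using gf by (simp_all add: action_cat_simps)
  have \<phi>: "\<phi> v \<in> FObj S x" and V: "v \<in> V" and \<psi>: "\<psi> (\<phi> v) \<in> FObj R x"
    if "x \<in> Obj G" "v \<in> FObj T x" for v x
    using that m action_in[OF T that] by (fastforce simp: action_morphism_def)+
  have "action_morphism G V T W R (compose V \<psi> \<phi>)"
    unfolding action_morphism_def
  proof (intro conjI ballI)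
    show "compose V \<psi> \<phi> \<in> V \<rightarrow>\<^sub>E W" using m by (auto simp: action_morphism_def compose_def)
    show "compose V \<psi> \<phi> ` FObj T x \<subseteq> FObj R x" if "x \<in> Obj G" for x
      using \<psi>[OF that] V[OF that] by (auto simp: compose_eq)
    fix a v assume a: "a \<in> Arr G" and v: "v \<in> FObj T (src G a)"
    have "act T a v \<in> V" "v \<in> V"
      using V category_src[OF G a] category_tgt[OF G a] act_in[OF action_functor[OF T] a v] v
      by auto
    then show "compose V \<psi> \<phi> (act T a v) = act R a (compose V \<psi> \<phi> v)"
      using m a v \<phi>[OF category_src[OF G a] v] by (simp add: compose_eq action_morphism_def)
  qed
  then show "cmp ?C g f \<in> Arr ?C \<and> src ?C (cmp ?C g f) = src ?C f \<and>
      tgt ?C (cmp ?C g f) = tgt ?C g"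
    using gf by (simp add: action_cat_simps)
next
  fix h g f assume hgf: "h \<in> Arr ?C" "g \<in> Arr ?C" "f \<in> Arr ?C"
    "src ?C h = tgt ?C g" "src ?C g = tgt ?C f"
  obtain V T \<phi> U S \<psi> W R \<chi> Z Q where [simp]: "f = ((V, T), \<phi>, (U, S))"
    "g = ((U, S), \<psi>, (W, R))" "h = ((W, R), \<chi>, (Z, Q))"
    using hgf(4,5) by (cases f; cases g; cases h) (auto simp: action_cat_simps)
  have "\<phi> \<in> V \<rightarrow> U" using hgf(3) by (auto simp: action_cat_simps action_morphism_def)
  then show "cmp ?C h (cmp ?C g f) = cmp ?C (cmp ?C h g) f"
    by (simp add: action_cat_simps compose_assoc)
qed

section \<open>The action of the fundamental groupoid on the vertices of a covering\<close>

definition path_lift :: "('v, 'm) kgraph \<Rightarrow> ('v, 'm, 'x, 'a) fctr \<Rightarrow> 'a \<Rightarrow> 'v \<Rightarrow> 'm" where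
  "path_lift \<Omega> p \<alpha> v = inv_into (arrows_from \<Omega> v) (FArr p) \<alpha>"

definition vertex_fibre :: "('v, 'm) kgraph \<Rightarrow> ('v, 'm, 'x, 'a) fctr \<Rightarrow> 'x \<Rightarrow> 'v set" where
  "vertex_fibre \<Omega> p x = {v \<in> Obj \<Omega>. FObj p v = x}"

lemma
  assumes p: "covering k \<Lambda> \<Omega> p" and \<alpha>: "\<alpha> \<in> Arr \<Lambda>" and v: "v \<in> vertex_fibre \<Omega> p (src \<Lambda> \<alpha>)"
  shows path_lift_Arr: "path_lift \<Omega> p \<alpha> v \<in> Arr \<Omega>"
    and src_path_lift: "src \<Omega> (path_lift \<Omega> p \<alpha> v) = v"
    and FArr_path_lift: "FArr p (path_lift \<Omega> p \<alpha> v) = \<alpha>"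
    and tgt_path_lift: "tgt \<Omega> (path_lift \<Omega> p \<alpha> v) \<in> vertex_fibre \<Omega> p (tgt \<Lambda> \<alpha>)"
proof -
  have "\<alpha> \<in> FArr p ` arrows_from \<Omega> v"
    using covering_bij_from[OF p, of v] \<alpha> v
    by (auto simp: vertex_fibre_def bij_betw_def arrows_from_def)
  from inv_into_into[OF this] f_inv_into_f[OF this]
  show l: "path_lift \<Omega> p \<alpha> v \<in> Arr \<Omega>" "src \<Omega> (path_lift \<Omega> p \<alpha> v) = v"
    "FArr p (path_lift \<Omega> p \<alpha> v) = \<alpha>"
    by (simp_all add: path_lift_def arrows_from_def)
  show "tgt \<Omega> (path_lift \<Omega> p \<alpha> v) \<in> vertex_fibre \<Omega> p (tgt \<Lambda> \<alpha>)"
    using category_tgt[OF covering_category[OF p] l(1)] functor_tgt[OF covering_functor[OF p] l(1)]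
      l(3) by (simp add: vertex_fibre_def)
qed

text \<open>Uniqueness of lifts, that is, injectivity of \<open>p\<close> on the arrows leaving
  \<open>v\<close>. It is the tool for identities between lifts: it suffices to name a morphism with
  the right source and image, for instance an identity, a composite, or the image under a morphism
  of coverings.\<close>

lemma path_lift_eqI:
  assumes "covering k \<Lambda> \<Omega> p" "\<mu> \<in> Arr \<Omega>" "FArr p \<mu> = \<alpha>" "src \<Omega> \<mu> = v"
  shows "path_lift \<Omega> p \<alpha> v = \<mu>"
proof -
  have "v \<in> Obj \<Omega>" using category_src[OF covering_category[OF assms(1)] assms(2)] assms(4) by simp
  then have "inj_on (FArr p) (arrows_from \<Omega> v)"
    using covering_bij_from[OF assms(1)] by (auto simp: bij_betw_def)
  moreover have "\<mu> \<in> arrows_from \<Omega> v" using assms by (simp add: arrows_from_def)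
  ultimately show ?thesis
    using assms(3) by (auto simp: path_lift_def)
qed

lemma src_in_vertex_fibre:
  assumes "covering k \<Lambda> \<Omega> p" "\<mu> \<in> Arr \<Omega>"
  shows "src \<Omega> \<mu> \<in> vertex_fibre \<Omega> p (src \<Lambda> (FArr p \<mu>))"
  using category_src[OF covering_category[OF assms(1)] assms(2)]
    functor_src[OF covering_functor[OF assms(1)] assms(2)] by (simp add: vertex_fibre_def)

lemma path_lift_ident:
  assumes "covering k \<Lambda> \<Omega> p" "v \<in> vertex_fibre \<Omega> p x"
  shows "path_lift \<Omega> p (ident \<Lambda> x) v = ident \<Omega> v"
  using assms(2)
  by (intro path_lift_eqI[OF assms(1)])
    (auto simp: vertex_fibre_def category_rules[OF covering_category[OF assms(1)]]
      functor_ident[OF covering_functor[OF assms(1)]])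

lemma path_lift_cmp:
  assumes p: "covering k \<Lambda> \<Omega> p" and ab: "\<alpha> \<in> Arr \<Lambda>" "\<beta> \<in> Arr \<Lambda>" "src \<Lambda> \<alpha> = tgt \<Lambda> \<beta>"
    and v: "v \<in> vertex_fibre \<Omega> p (src \<Lambda> \<beta>)"
  shows "path_lift \<Omega> p (cmp \<Lambda> \<alpha> \<beta>) v =
    cmp \<Omega> (path_lift \<Omega> p \<alpha> (tgt \<Omega> (path_lift \<Omega> p \<beta> v))) (path_lift \<Omega> p \<beta> v)"
proof -
  let ?w = "tgt \<Omega> (path_lift \<Omega> p \<beta> v)"
  note \<beta> = path_lift_Arr[OF p ab(2) v] src_path_lift[OF p ab(2) v] FArr_path_lift[OF p ab(2) v]
  have w: "?w \<in> vertex_fibre \<Omega> p (src \<Lambda> \<alpha>)" using tgt_path_lift[OF p ab(2) v] ab(3) by simp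
  note \<alpha> = path_lift_Arr[OF p ab(1) w] src_path_lift[OF p ab(1) w] FArr_path_lift[OF p ab(1) w]
  note c = covering_category[OF p]
  show ?thesis
    by (rule path_lift_eqI[OF p])
      (simp_all add: category_cmp[OF c \<alpha>(1) \<beta>(1)] category_src_cmp[OF c \<alpha>(1) \<beta>(1)]
        functor_cmp[OF covering_functor[OF p] \<alpha>(1) \<beta>(1)] \<alpha> \<beta>)
qed

text \<open>This rests on the second half of the covering condition, bijectivity on arrows with a
  given target. Two lifts of \<open>\<alpha>\<close> with the same end coincide, hence so do their
  sources; a vertex over the target of \<open>\<alpha>\<close> is reached by lifting
  \<open>\<alpha>\<close> backwards from it.\<close>

lemma bij_betw_tgt_path_lift:
  assumes p: "covering k \<Lambda> \<Omega> p" and \<alpha>: "\<alpha> \<in> Arr \<Lambda>"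
  shows "bij_betw (\<lambda>v. tgt \<Omega> (path_lift \<Omega> p \<alpha> v))
    (vertex_fibre \<Omega> p (src \<Lambda> \<alpha>)) (vertex_fibre \<Omega> p (tgt \<Lambda> \<alpha>))"
  unfolding bij_betw_def
proof (intro conjI inj_onI equalityI subsetI)
  note c = covering_category[OF p]
  fix v w assume vw: "v \<in> vertex_fibre \<Omega> p (src \<Lambda> \<alpha>)" "w \<in> vertex_fibre \<Omega> p (src \<Lambda> \<alpha>)"
    "tgt \<Omega> (path_lift \<Omega> p \<alpha> v) = tgt \<Omega> (path_lift \<Omega> p \<alpha> w)"
  let ?u = "tgt \<Omega> (path_lift \<Omega> p \<alpha> w)"
  have "inj_on (FArr p) (arrows_to \<Omega> ?u)"
    using covering_bij_to[OF p category_tgt[OF c path_lift_Arr[OF p \<alpha> vw(2)]]]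
    by (simp add: bij_betw_def)
  then have "path_lift \<Omega> p \<alpha> v = path_lift \<Omega> p \<alpha> w"
    by (rule inj_onD)
      (simp_all add: arrows_to_def FArr_path_lift[OF p \<alpha>] path_lift_Arr[OF p \<alpha>] vw)
  then show "v = w" using src_path_lift[OF p \<alpha>] vw by metis
next
  fix u assume u: "u \<in> vertex_fibre \<Omega> p (tgt \<Lambda> \<alpha>)"
  then have "\<alpha> \<in> FArr p ` arrows_to \<Omega> u"
    using covering_bij_to[OF p, of u] \<alpha> by (simp add: vertex_fibre_def bij_betw_def arrows_to_def)
  then obtain \<mu> where \<mu>: "\<mu> \<in> Arr \<Omega>" "FArr p \<mu> = \<alpha>" "tgt \<Omega> \<mu> = u"
    by (auto simp: arrows_to_def)
  have "src \<Omega> \<mu> \<in> vertex_fibre \<Omega> p (src \<Lambda> \<alpha>)"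
    using src_in_vertex_fibre[OF p \<mu>(1)] \<mu>(2) by simp
  moreover have "path_lift \<Omega> p \<alpha> (src \<Omega> \<mu>) = \<mu>" by (rule path_lift_eqI[OF p \<mu>(1,2)]) simp
  ultimately show "u \<in> (\<lambda>v. tgt \<Omega> (path_lift \<Omega> p \<alpha> v)) ` vertex_fibre \<Omega> p (src \<Lambda> \<alpha>)"
    using \<mu>(3) by force
qed (auto simp: tgt_path_lift[OF p \<alpha>])

text \<open>Eliminates the description operator in \<open>lift_action\<close>. Every
  \<open>\<alpha>\<close> with a vertex \<open>v\<close> over its source is the image of a morphism
  starting at \<open>v\<close>, so the lifting condition prescribes the action of each
  \<open>FArr i \<alpha>\<close> completely, and \<open>set_functor_determined\<close> extends the
  agreement to \<open>G\<close>.\<close>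

lemma lift_action_eqI:
  fixes T :: "('x, 'g, 'v) set_functor" and \<Lambda> :: "('x, 'a) kgraph"
  assumes fg: "fundamental_groupoid TYPE('v sets) \<Lambda> G i" and cat: "category \<Lambda>"
    and p: "covering k \<Lambda> \<Omega> p" and T: "action G (Obj \<Omega>) T"
    and fib: "\<And>x. x \<in> Obj G \<Longrightarrow> FObj T x = vertex_fibre \<Omega> p x"
    and lift: "\<And>\<mu>. \<mu> \<in> Arr \<Omega> \<Longrightarrow> act T (FArr i (FArr p \<mu>)) (src \<Omega> \<mu>) = tgt \<Omega> \<mu>"
  shows "lift_action G i \<Omega> p = T"
  unfolding lift_action_def
proof (rule the_equality)
  fix S :: "('x, 'g, 'v) set_functor"
  assume S: "action G (Obj \<Omega>) S \<and> (\<forall>x\<in>Obj G. FObj S x = {v \<in> Obj \<Omega>. FObj p v = x}) \<and>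
    (\<forall>\<mu>\<in>Arr \<Omega>. act S (FArr i (FArr p \<mu>)) (src \<Omega> \<mu>) = tgt \<Omega> \<mu>)"
  show "S = T"
  proof (rule set_functor_determined[OF fg cat])
    show "is_functor G set_cat S" "is_functor G set_cat T"
      using S T by (auto intro: action_functor)
    show o: "FObj S x = FObj T x" if "x \<in> Obj G" for x
      using S fib that by (simp add: vertex_fibre_def)
    fix \<alpha> v assume a: "\<alpha> \<in> Arr \<Lambda>" "v \<in> FObj S (src \<Lambda> \<alpha>)"
    then have v: "v \<in> vertex_fibre \<Omega> p (src \<Lambda> \<alpha>)"
      using o fib category_src[OF cat a(1)] fundamental_groupoid_Obj[OF fg] by simp
    show "act S (FArr i \<alpha>) v = act T (FArr i \<alpha>) v"
      using S lift path_lift_Arr[OF p a(1) v] src_path_lift[OF p a(1) v]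
        FArr_path_lift[OF p a(1) v] by metis
  qed
qed (use T fib lift in \<open>auto simp: vertex_fibre_def\<close>)

text \<open>Existence of the action that \<open>lift_action\<close> describes; after this the
  description itself is replaced by these three facts. Targets of lifts give a functor on
  \<open>\<Lambda>\<close>, because lifts respect identities and composites, and it acts by
  bijections, so it extends to \<open>G\<close>.\<close>

lemma
  fixes \<Lambda> :: "('x, 'a) kgraph" and \<Omega> :: "('v, 'm) kgraph"
  assumes fg: "fundamental_groupoid TYPE('v sets) \<Lambda> G i" and cat: "category \<Lambda>"
    and p: "covering k \<Lambda> \<Omega> p"
  shows action_lift_action: "action G (Obj \<Omega>) (lift_action G i \<Omega> p)"
    and FObj_lift_action: "x \<in> Obj G \<Longrightarrow> FObj (lift_action G i \<Omega> p) x = vertex_fibre \<Omega> p x"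
    and act_lift_action: "\<alpha> \<in> Arr \<Lambda> \<Longrightarrow> v \<in> vertex_fibre \<Omega> p (src \<Lambda> \<alpha>) \<Longrightarrow>
      act (lift_action G i \<Omega> p) (FArr i \<alpha>) v = tgt \<Omega> (path_lift \<Omega> p \<alpha> v)"
proof -
  note oG = fundamental_groupoid_Obj[OF fg]
  define F where
    "F = set_functor \<Lambda> (vertex_fibre \<Omega> p) (\<lambda>\<alpha> v. tgt \<Omega> (path_lift \<Omega> p \<alpha> v))"
  note c = covering_category[OF p]
  have "is_functor \<Lambda> set_cat F"
    unfolding F_def
  proof (rule is_functor_set_functor[OF cat])
    show "tgt \<Omega> (path_lift \<Omega> p \<alpha> v) \<in> vertex_fibre \<Omega> p (tgt \<Lambda> \<alpha>)"
      if "\<alpha> \<in> Arr \<Lambda>" "v \<in> vertex_fibre \<Omega> p (src \<Lambda> \<alpha>)" for \<alpha> v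
      using tgt_path_lift[OF p that] .
    show "tgt \<Omega> (path_lift \<Omega> p (ident \<Lambda> x) v) = v"
      if "x \<in> Obj \<Lambda>" "v \<in> vertex_fibre \<Omega> p x" for x v
      using that(2) path_lift_ident[OF p that(2)]
      by (simp add: vertex_fibre_def category_tgt_ident[OF c])
  next
    fix a b v assume ab: "a \<in> Arr \<Lambda>" "b \<in> Arr \<Lambda>" "src \<Lambda> a = tgt \<Lambda> b"
      and v: "v \<in> vertex_fibre \<Omega> p (src \<Lambda> b)"
    have w: "tgt \<Omega> (path_lift \<Omega> p b v) \<in> vertex_fibre \<Omega> p (src \<Lambda> a)"
      using tgt_path_lift[OF p ab(2) v] ab(3) by simp
    show "tgt \<Omega> (path_lift \<Omega> p (cmp \<Lambda> a b) v) =
        tgt \<Omega> (path_lift \<Omega> p a (tgt \<Omega> (path_lift \<Omega> p b v)))"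
      by (simp add: path_lift_cmp[OF p ab v] category_tgt_cmp[OF c path_lift_Arr[OF p ab(1) w]
            path_lift_Arr[OF p ab(2) v] src_path_lift[OF p ab(1) w]])
  qed
  moreover have F: "FObj F x = vertex_fibre \<Omega> p x" if "x \<in> Obj \<Lambda>" for x
    using that by (simp add: F_def FObj_set_functor)
  moreover have aF: "act F \<alpha> v = tgt \<Omega> (path_lift \<Omega> p \<alpha> v)"
    if "\<alpha> \<in> Arr \<Lambda>" "v \<in> vertex_fibre \<Omega> p (src \<Lambda> \<alpha>)" for \<alpha> v
    using that by (simp add: F_def act_set_functor)
  moreover have "bij_betw (act F \<alpha>) (vertex_fibre \<Omega> p (src \<Lambda> \<alpha>)) (vertex_fibre \<Omega> p (tgt \<Lambda> \<alpha>))"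
    if "\<alpha> \<in> Arr \<Lambda>" for \<alpha>
    using bij_betw_cong[of _ "act F \<alpha>", OF aF[OF that]] bij_betw_tgt_path_lift[OF p that] by blast
  \<comment> \<open>With the constantly true relation only bijectivity is asked.\<close>
  ultimately have "is_functor \<Lambda> (rel_groupoid (\<lambda>_ _. True)) F"
    by (simp add: is_functor_rel_groupoid_iff category_rules[OF cat])
  then obtain T where T: "is_functor G (rel_groupoid (\<lambda>_ _. True)) T"
    "\<And>x. x \<in> Obj G \<Longrightarrow> FObj T x = FObj F x"
    "\<And>\<alpha> v. \<alpha> \<in> Arr \<Lambda> \<Longrightarrow> act T (FArr i \<alpha>) v = act F \<alpha> v"
    using set_functor_extension[OF fg] by blast
  have fib: "FObj T x = vertex_fibre \<Omega> p x" if "x \<in> Obj G" for x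
    using T(2) F that oG by simp
  have "v \<in> (\<Union>x\<in>Obj G. vertex_fibre \<Omega> p x)" if "v \<in> Obj \<Omega>" for v
    using that functor_Obj[OF covering_functor[OF p] that] oG by (simp add: vertex_fibre_def)
  then have T_act: "action G (Obj \<Omega>) T"
    using T(1) fib by (auto simp: action_def is_functor_rel_groupoid_iff vertex_fibre_def)
  have eq: "lift_action G i \<Omega> p = T"
  proof (rule lift_action_eqI[OF fg cat p T_act fib])
    fix \<mu> assume \<mu>: "\<mu> \<in> Arr \<Omega>"
    show "act T (FArr i (FArr p \<mu>)) (src \<Omega> \<mu>) = tgt \<Omega> \<mu>"
      using T(3) aF src_in_vertex_fibre[OF p \<mu>] functor_Arr[OF covering_functor[OF p] \<mu>]
        path_lift_eqI[OF p \<mu> refl refl] by simp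
  qed
  show "action G (Obj \<Omega>) (lift_action G i \<Omega> p)"
    "x \<in> Obj G \<Longrightarrow> FObj (lift_action G i \<Omega> p) x = vertex_fibre \<Omega> p x"
    "\<alpha> \<in> Arr \<Lambda> \<Longrightarrow> v \<in> vertex_fibre \<Omega> p (src \<Lambda> \<alpha>) \<Longrightarrow>
      act (lift_action G i \<Omega> p) (FArr i \<alpha>) v = tgt \<Omega> (path_lift \<Omega> p \<alpha> v)"
    unfolding eq using T_act fib T(3) aF by simp_all
qed

lemma fibres_nonempty_lift_action:
  fixes \<Lambda> :: "('x, 'a) kgraph" and \<Omega> :: "('v, 'm) kgraph"
  assumes fg: "fundamental_groupoid TYPE('v sets) \<Lambda> G i" and cat: "category \<Lambda>"
    and p: "covering k \<Lambda> \<Omega> p"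
  shows "fibres_nonempty G (lift_action G i \<Omega> p)"
  unfolding fibres_nonempty_def
proof
  fix x assume x: "x \<in> Obj G"
  then have "x \<in> FObj p ` Obj \<Omega>"
    using covering_surj[OF p] fundamental_groupoid_Obj[OF fg] by simp
  then show "FObj (lift_action G i \<Omega> p) x \<noteq> {}"
    using FObj_lift_action[OF fg cat p x] by (auto simp: vertex_fibre_def)
qed

text \<open>The image of a lift under \<open>\<phi>\<close> has the source and the image in
  \<open>\<Lambda>\<close> that a lift to \<open>\<Sigma>\<close> must have, so uniqueness applies.
  This one identity yields both the equivariance of \<open>\<phi>\<close> along
  \<open>\<Lambda>\<close> and the naturality of the counit.\<close>

lemma path_lift_covering_morphism:
  assumes p: "covering k \<Lambda> \<Omega> p" and q: "covering k \<Lambda> \<Sigma> q" and \<phi>: "covering_morphism \<Omega> p \<Sigma> q \<phi>"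
    and a: "\<alpha> \<in> Arr \<Lambda>" and v: "v \<in> vertex_fibre \<Omega> p (src \<Lambda> \<alpha>)"
  shows "path_lift \<Sigma> q \<alpha> (FObj \<phi> v) = FArr \<phi> (path_lift \<Omega> p \<alpha> v)"
proof -
  note l = path_lift_Arr[OF p a v]
  note f = covering_morphism_functor[OF \<phi>]
  show ?thesis
    by (rule path_lift_eqI[OF q functor_Arr[OF f l]])
      (simp_all add: covering_morphism_FArr[OF \<phi> l] functor_src[OF f l] FArr_path_lift[OF p a v]
        src_path_lift[OF p a v])
qed

lemma covering_morphism_vertex_fibre:
  assumes "covering_morphism \<Omega> p \<Sigma> q \<phi>" "v \<in> vertex_fibre \<Omega> p x"
  shows "FObj \<phi> v \<in> vertex_fibre \<Sigma> q x"
  using assms functor_Obj[OF covering_morphism_functor[OF assms(1)]]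
    covering_morphism_FObj[OF assms(1)] by (simp add: vertex_fibre_def)

text \<open>Taking targets in \<open>path_lift_covering_morphism\<close> gives equivariance along
  \<open>\<Lambda>\<close>; \<open>action_morphismI\<close> carries it over to the arrows of
  \<open>G\<close>.\<close>

lemma action_morphism_of_covering_morphism:
  fixes \<Lambda> :: "('x, 'a) kgraph" and \<Omega> \<Sigma> :: "('v, 'm) kgraph"
  assumes fg: "fundamental_groupoid TYPE('v sets) \<Lambda> G i" and cat: "category \<Lambda>"
    and p: "covering k \<Lambda> \<Omega> p" and q: "covering k \<Lambda> \<Sigma> q" and \<phi>: "covering_morphism \<Omega> p \<Sigma> q \<phi>"
  shows "action_morphism G (Obj \<Omega>) (lift_action G i \<Omega> p) (Obj \<Sigma>) (lift_action G i \<Sigma> q) (FObj \<phi>)"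
proof (rule action_morphismI[OF fg cat action_lift_action[OF fg cat p]
      action_lift_action[OF fg cat q]])
  note f = covering_morphism_functor[OF \<phi>]
  show "FObj \<phi> \<in> Obj \<Omega> \<rightarrow>\<^sub>E Obj \<Sigma>"
    using f by (simp add: is_functor_def)
  show "FObj \<phi> v \<in> FObj (lift_action G i \<Sigma> q) x"
    if "x \<in> Obj G" "v \<in> FObj (lift_action G i \<Omega> p) x" for x v
    using that covering_morphism_vertex_fibre[OF \<phi>]
    by (simp add: FObj_lift_action[OF fg cat p] FObj_lift_action[OF fg cat q])
  fix \<alpha> v assume a: "\<alpha> \<in> Arr \<Lambda>" and "v \<in> FObj (lift_action G i \<Omega> p) (src \<Lambda> \<alpha>)"
  then have v: "v \<in> vertex_fibre \<Omega> p (src \<Lambda> \<alpha>)"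
    using FObj_lift_action[OF fg cat p] category_src[OF cat a] fundamental_groupoid_Obj[OF fg]
    by simp
  show "FObj \<phi> (act (lift_action G i \<Omega> p) (FArr i \<alpha>) v) =
      act (lift_action G i \<Sigma> q) (FArr i \<alpha>) (FObj \<phi> v)"
    by (simp add: act_lift_action[OF fg cat p a v] path_lift_covering_morphism[OF p q \<phi> a v]
        act_lift_action[OF fg cat q a covering_morphism_vertex_fibre[OF \<phi> v]]
        functor_tgt[OF f path_lift_Arr[OF p a v]])
qed

section \<open>The covering associated with an action\<close>

lemma base_point_eq:
  assumes "action G V T" "Obj G = Obj \<Lambda>" "x \<in> Obj \<Lambda>" "v \<in> FObj T x"
  shows "base_point \<Lambda> T v = x"
  unfolding base_point_def
  using assms action_disjoint[OF assms(1)] by (intro the_equality) auto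

lemma base_point_fibre:
  assumes "action G V T" "Obj G = Obj \<Lambda>" "v \<in> V"
  shows "base_point \<Lambda> T v \<in> Obj \<Lambda>" "v \<in> FObj T (base_point \<Lambda> T v)"
  using action_fibre[OF assms(1,3)] base_point_eq[OF assms(1,2)] assms(2) by auto

lemma star_graph_simps:
  "Obj (star_graph \<Lambda> i V T) = V"
  "(\<alpha>, v) \<in> Arr (star_graph \<Lambda> i V T) \<longleftrightarrow> \<alpha> \<in> Arr \<Lambda> \<and> v \<in> FObj T (src \<Lambda> \<alpha>)"
  "src (star_graph \<Lambda> i V T) (\<alpha>, v) = v"
  "tgt (star_graph \<Lambda> i V T) (\<alpha>, v) = act T (FArr i \<alpha>) v"
  "ident (star_graph \<Lambda> i V T) v = (ident \<Lambda> (base_point \<Lambda> T v), v)"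
  "cmp (star_graph \<Lambda> i V T) (\<alpha>, w) (\<beta>, v) = (cmp \<Lambda> \<alpha> \<beta>, v)"
  "deg (star_graph \<Lambda> i V T) (\<alpha>, v) = deg \<Lambda> \<alpha>"
  by (simp_all add: star_graph_def)

lemma
  assumes fg: "fundamental_groupoid t \<Lambda> G i" and cat: "category \<Lambda>" and T: "action G V T"
    and a: "\<alpha> \<in> Arr \<Lambda>" and v: "v \<in> FObj T (src \<Lambda> \<alpha>)"
  shows star_fibre: "v \<in> V" "base_point \<Lambda> T v = src \<Lambda> \<alpha>"
    and star_act: "act T (FArr i \<alpha>) v \<in> FObj T (tgt \<Lambda> \<alpha>)"
    and star_act_in: "act T (FArr i \<alpha>) v \<in> V"
    and star_base_point_act: "base_point \<Lambda> T (act T (FArr i \<alpha>) v) = tgt \<Lambda> \<alpha>"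
proof -
  note oG = fundamental_groupoid_Obj[OF fg]
  note st = category_src[OF cat a] category_tgt[OF cat a]
  show "v \<in> V" "base_point \<Lambda> T v = src \<Lambda> \<alpha>"
    using action_in[OF T] base_point_eq[OF T oG] st v oG by simp_all
  show 1: "act T (FArr i \<alpha>) v \<in> FObj T (tgt \<Lambda> \<alpha>)"
    using act_in[OF action_functor[OF T] fundamental_groupoid_arr[OF fg a]] v
    by (simp add: fundamental_groupoid_src[OF fg cat a] fundamental_groupoid_tgt[OF fg cat a])
  show "act T (FArr i \<alpha>) v \<in> V" "base_point \<Lambda> T (act T (FArr i \<alpha>) v) = tgt \<Lambda> \<alpha>"
    using action_in[OF T] base_point_eq[OF T oG] st 1 oG by simp_all
qed

text \<open>Composability in the star graph is an equality of points of \<open>V\<close>, in which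
  the vertex of \<open>\<Lambda>\<close> is not recorded. Disjointness of the fibres, through
  \<open>base_point\<close>, recovers composability in \<open>\<Lambda>\<close>.\<close>

lemma star_composable:
  assumes fg: "fundamental_groupoid t \<Lambda> G i" and cat: "category \<Lambda>" and T: "action G V T"
    and "\<alpha> \<in> Arr \<Lambda>" "\<beta> \<in> Arr \<Lambda>" "v \<in> FObj T (src \<Lambda> \<beta>)"
    and "act T (FArr i \<beta>) v \<in> FObj T (src \<Lambda> \<alpha>)"
  shows "src \<Lambda> \<alpha> = tgt \<Lambda> \<beta>"
  using star_base_point_act[OF fg cat T assms(5,6)] star_fibre(2)[OF fg cat T assms(4,7)] by simp

lemma star_act_cmp:
  assumes fg: "fundamental_groupoid t \<Lambda> G i" and cat: "category \<Lambda>" and T: "action G V T"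
    and ab: "\<alpha> \<in> Arr \<Lambda>" "\<beta> \<in> Arr \<Lambda>" "src \<Lambda> \<alpha> = tgt \<Lambda> \<beta>" and v: "v \<in> FObj T (src \<Lambda> \<beta>)"
  shows "act T (FArr i (cmp \<Lambda> \<alpha> \<beta>)) v = act T (FArr i \<alpha>) (act T (FArr i \<beta>) v)"
proof -
  note iG = fundamental_groupoid_arr[OF fg] fundamental_groupoid_src[OF fg cat]
    fundamental_groupoid_tgt[OF fg cat]
  show ?thesis
    using act_cmp[OF action_functor[OF T] iG(1)[OF ab(1)] iG(1)[OF ab(2)]] ab v
    by (simp add: functor_cmp[OF fundamental_groupoid_functor[OF fg] ab] iG(2,3))
qed

lemma star_act_ident:
  assumes fg: "fundamental_groupoid t \<Lambda> G i" and T: "action G V T"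
    and "x \<in> Obj \<Lambda>" "v \<in> FObj T x"
  shows "act T (FArr i (ident \<Lambda> x)) v = v"
  using assms(3,4) act_ident[OF action_functor[OF T]] fundamental_groupoid_Obj[OF fg]
    functor_ident[OF fundamental_groupoid_functor[OF fg]] fundamental_groupoid_FObj[OF fg] by simp

lemma category_star_graph:
  assumes fg: "fundamental_groupoid t \<Lambda> G i" and cat: "category \<Lambda>" and T: "action G V T"
  shows "category (star_graph \<Lambda> i V T)" (is "category ?S")
proof (rule categoryI)
  fix f assume "f \<in> Arr ?S"
  then obtain \<alpha> v where [simp]: "f = (\<alpha>, v)" and a: "\<alpha> \<in> Arr \<Lambda>" "v \<in> FObj T (src \<Lambda> \<alpha>)"
    by (cases f) (simp add: star_graph_simps)
  note s = star_fibre[OF fg cat T a] star_act_in[OF fg cat T a] star_base_point_act[OF fg cat T a]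
  show "src ?S f \<in> Obj ?S \<and> tgt ?S f \<in> Obj ?S" by (simp add: star_graph_simps s)
  show "cmp ?S f (ident ?S (src ?S f)) = f \<and> cmp ?S (ident ?S (tgt ?S f)) f = f"
    by (simp add: star_graph_simps s category_cmp_ident[OF cat a(1)]
        category_ident_cmp[OF cat a(1)])
next
  fix v assume "v \<in> Obj ?S"
  then have v: "v \<in> V" by (simp add: star_graph_simps)
  note b = base_point_fibre[OF T fundamental_groupoid_Obj[OF fg] v]
  show "ident ?S v \<in> Arr ?S \<and> src ?S (ident ?S v) = v \<and> tgt ?S (ident ?S v) = v"
    by (simp add: star_graph_simps b category_ident[OF cat b(1)] category_src_ident[OF cat b(1)]
        star_act_ident[OF fg T b])
next
  fix g f assume gf: "g \<in> Arr ?S" "f \<in> Arr ?S" "src ?S g = tgt ?S f"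
  obtain \<alpha> \<beta> v where [simp]: "g = (\<alpha>, act T (FArr i \<beta>) v)" "f = (\<beta>, v)"
    using gf(3) by (cases g; cases f) (simp add: star_graph_simps)
  have ab: "\<alpha> \<in> Arr \<Lambda>" "\<beta> \<in> Arr \<Lambda>" "v \<in> FObj T (src \<Lambda> \<beta>)"
    "act T (FArr i \<beta>) v \<in> FObj T (src \<Lambda> \<alpha>)"
    using gf by (simp_all add: star_graph_simps)
  note m = star_composable[OF fg cat T ab]
  show "cmp ?S g f \<in> Arr ?S \<and> src ?S (cmp ?S g f) = src ?S f \<and> tgt ?S (cmp ?S g f) = tgt ?S g"
    by (simp add: star_graph_simps ab(3) category_cmp[OF cat ab(1,2) m]
        category_src_cmp[OF cat ab(1,2) m] star_act_cmp[OF fg cat T ab(1,2) m ab(3)])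
next
  fix h g f assume hgf: "h \<in> Arr ?S" "g \<in> Arr ?S" "f \<in> Arr ?S"
    "src ?S h = tgt ?S g" "src ?S g = tgt ?S f"
  obtain \<alpha> \<beta> \<gamma> w v where [simp]: "h = (\<alpha>, act T (FArr i \<beta>) w)" "g = (\<beta>, w)" "f = (\<gamma>, v)"
    and w: "w = act T (FArr i \<gamma>) v"
    using hgf(4,5) by (cases h; cases g; cases f) (simp add: star_graph_simps)
  have a: "\<alpha> \<in> Arr \<Lambda>" "\<beta> \<in> Arr \<Lambda>" "\<gamma> \<in> Arr \<Lambda>" "v \<in> FObj T (src \<Lambda> \<gamma>)"
    "act T (FArr i \<beta>) w \<in> FObj T (src \<Lambda> \<alpha>)" "w \<in> FObj T (src \<Lambda> \<beta>)"
    using hgf(1-3) by (simp_all add: star_graph_simps)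
  show "cmp ?S h (cmp ?S g f) = cmp ?S (cmp ?S h g) f"
    using category_assoc[OF cat a(1-3) star_composable[OF fg cat T a(1,2,6,5)]
        star_composable[OF fg cat T a(2,3,4) a(6)[unfolded w]]]
    by (simp add: star_graph_simps)
qed

text \<open>A factorization of \<open>(\<alpha>, v)\<close> is one of \<open>\<alpha>\<close> with
  forced second entries: the right factor must start at \<open>v\<close>, and the left factor where
  the right one ends. Existence and uniqueness are thus inherited from
  \<open>\<Lambda>\<close>.\<close>

lemma k_graph_star_graph:
  assumes fg: "fundamental_groupoid t \<Lambda> G i" and \<Lambda>: "k_graph k \<Lambda>" and T: "action G V T"
  shows "k_graph k (star_graph \<Lambda> i V T)" (is "k_graph k ?S")
proof -
  have cat: "category \<Lambda>" using \<Lambda> by (simp add: k_graph_def)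
  have fact: "\<exists>!(\<mu>, \<nu>). \<mu> \<in> Arr ?S \<and> \<nu> \<in> Arr ?S \<and> src ?S \<mu> = tgt ?S \<nu> \<and>
      deg ?S \<mu> = n \<and> deg ?S \<nu> = l \<and> \<kappa> = cmp ?S \<mu> \<nu>"
    if \<kappa>: "\<kappa> \<in> Arr ?S" and nl: "n \<in> Nk k" "l \<in> Nk k" "deg ?S \<kappa> = n + l" for \<kappa> n l
  proof -
    obtain \<alpha> v where [simp]: "\<kappa> = (\<alpha>, v)" and a: "\<alpha> \<in> Arr \<Lambda>" "v \<in> FObj T (src \<Lambda> \<alpha>)"
      using \<kappa> by (cases \<kappa>) (simp add: star_graph_simps)
    have "\<exists>!(\<beta>, \<gamma>). \<beta> \<in> Arr \<Lambda> \<and> \<gamma> \<in> Arr \<Lambda> \<and> src \<Lambda> \<beta> = tgt \<Lambda> \<gamma> \<and>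
        deg \<Lambda> \<beta> = n \<and> deg \<Lambda> \<gamma> = l \<and> \<alpha> = cmp \<Lambda> \<beta> \<gamma>"
      using \<Lambda> a(1) nl unfolding k_graph_def by (simp add: star_graph_simps)
    then obtain \<beta> \<gamma> where f: "\<beta> \<in> Arr \<Lambda>" "\<gamma> \<in> Arr \<Lambda>" "src \<Lambda> \<beta> = tgt \<Lambda> \<gamma>"
        "deg \<Lambda> \<beta> = n" "deg \<Lambda> \<gamma> = l" "\<alpha> = cmp \<Lambda> \<beta> \<gamma>"
      and uniq: "\<And>\<beta>' \<gamma>'. \<beta>' \<in> Arr \<Lambda> \<Longrightarrow> \<gamma>' \<in> Arr \<Lambda> \<Longrightarrow> src \<Lambda> \<beta>' = tgt \<Lambda> \<gamma>' \<Longrightarrow>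
        deg \<Lambda> \<beta>' = n \<Longrightarrow> deg \<Lambda> \<gamma>' = l \<Longrightarrow> \<alpha> = cmp \<Lambda> \<beta>' \<gamma>' \<Longrightarrow> \<beta>' = \<beta> \<and> \<gamma>' = \<gamma>"
      unfolding Ex1_def by fast
    have v: "v \<in> FObj T (src \<Lambda> \<gamma>)" using a(2) f category_src_cmp[OF cat f(1-3)] by simp
    show ?thesis
    proof (rule ex1I[of _ "((\<beta>, act T (FArr i \<gamma>) v), (\<gamma>, v))"])
      show "case ((\<beta>, act T (FArr i \<gamma>) v), (\<gamma>, v)) of (\<mu>, \<nu>) \<Rightarrow> \<mu> \<in> Arr ?S \<and> \<nu> \<in> Arr ?S \<and>
          src ?S \<mu> = tgt ?S \<nu> \<and> deg ?S \<mu> = n \<and> deg ?S \<nu> = l \<and> \<kappa> = cmp ?S \<mu> \<nu>"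
        using f v star_act[OF fg cat T f(2) v] by (simp add: star_graph_simps)
    next
      fix z assume z: "case z of (\<mu>, \<nu>) \<Rightarrow> \<mu> \<in> Arr ?S \<and> \<nu> \<in> Arr ?S \<and>
          src ?S \<mu> = tgt ?S \<nu> \<and> deg ?S \<mu> = n \<and> deg ?S \<nu> = l \<and> \<kappa> = cmp ?S \<mu> \<nu>"
      obtain \<beta>' w \<gamma>' v' where [simp]: "z = ((\<beta>', w), (\<gamma>', v'))" by (metis prod.exhaust)
      have w: "w = act T (FArr i \<gamma>') v" "v' = v" "\<alpha> = cmp \<Lambda> \<beta>' \<gamma>'" "\<beta>' \<in> Arr \<Lambda>" "\<gamma>' \<in> Arr \<Lambda>"
        "v \<in> FObj T (src \<Lambda> \<gamma>')" "act T (FArr i \<gamma>') v \<in> FObj T (src \<Lambda> \<beta>')"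
        "deg \<Lambda> \<beta>' = n" "deg \<Lambda> \<gamma>' = l"
        using z by (auto simp: star_graph_simps)
      have "\<beta>' = \<beta> \<and> \<gamma>' = \<gamma>"
        using uniq[OF w(4,5) star_composable[OF fg cat T w(4-7)] w(8,9,3)] .
      then show "z = ((\<beta>, act T (FArr i \<gamma>) v), (\<gamma>, v))" using w(1,2) by simp
    qed
  qed
  have "deg ?S \<kappa> \<in> Nk k" if "\<kappa> \<in> Arr ?S" for \<kappa>
    using that \<Lambda> by (cases \<kappa>) (simp add: star_graph_simps k_graph_def)
  moreover have "deg ?S (ident ?S v) = 0" if "v \<in> Obj ?S" for v
    using that \<Lambda> base_point_fibre(1)[OF T fundamental_groupoid_Obj[OF fg], of v]
    by (simp add: star_graph_simps k_graph_def)
  moreover have "deg ?S (cmp ?S \<mu> \<nu>) = deg ?S \<mu> + deg ?S \<nu>"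
    if "\<mu> \<in> Arr ?S" "\<nu> \<in> Arr ?S" "src ?S \<mu> = tgt ?S \<nu>" for \<mu> \<nu>
  proof -
    obtain \<alpha> w \<beta> v where [simp]: "\<mu> = (\<alpha>, w)" "\<nu> = (\<beta>, v)" by (metis prod.exhaust)
    have ab: "\<alpha> \<in> Arr \<Lambda>" "\<beta> \<in> Arr \<Lambda>" "v \<in> FObj T (src \<Lambda> \<beta>)"
      "act T (FArr i \<beta>) v \<in> FObj T (src \<Lambda> \<alpha>)"
      using that by (auto simp: star_graph_simps)
    show ?thesis
      using \<Lambda> ab(1,2) star_composable[OF fg cat T ab] by (simp add: star_graph_simps k_graph_def)
  qed
  ultimately show ?thesis using category_star_graph[OF fg cat T] fact unfolding k_graph_def by blast
qed

lemma star_proj_simps: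
  "v \<in> V \<Longrightarrow> FObj (star_proj \<Lambda> i V T) v = base_point \<Lambda> T v"
  "(\<alpha>, v) \<in> Arr (star_graph \<Lambda> i V T) \<Longrightarrow> FArr (star_proj \<Lambda> i V T) (\<alpha>, v) = \<alpha>"
  by (simp_all add: star_proj_def)

lemma is_functor_star_proj:
  assumes fg: "fundamental_groupoid t \<Lambda> G i" and cat: "category \<Lambda>" and T: "action G V T"
  shows "is_functor (star_graph \<Lambda> i V T) \<Lambda> (star_proj \<Lambda> i V T)" (is "is_functor ?S \<Lambda> ?P")
proof (rule is_functorI)
  fix f assume f: "f \<in> Arr ?S"
  then obtain \<alpha> v where [simp]: "f = (\<alpha>, v)" and a: "\<alpha> \<in> Arr \<Lambda>" "v \<in> FObj T (src \<Lambda> \<alpha>)"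
    by (cases f) (simp add: star_graph_simps)
  note s = star_fibre[OF fg cat T a] star_act_in[OF fg cat T a] star_base_point_act[OF fg cat T a]
  show "FArr ?P f \<in> Arr \<Lambda>" "src \<Lambda> (FArr ?P f) = FObj ?P (src ?S f)"
    "tgt \<Lambda> (FArr ?P f) = FObj ?P (tgt ?S f)"
    using a by (simp_all add: star_proj_simps star_graph_simps s)
next
  fix v assume v: "v \<in> Obj ?S"
  then show "FObj ?P v \<in> Obj \<Lambda>"
    using base_point_fibre[OF T fundamental_groupoid_Obj[OF fg]]
    by (simp add: star_proj_simps star_graph_simps)
  show "FArr ?P (ident ?S v) = ident \<Lambda> (FObj ?P v)"
    using v category_ident[OF category_star_graph[OF fg cat T] v]
    by (simp add: star_proj_simps star_graph_simps(1,5))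
next
  fix g f assume gf: "g \<in> Arr ?S" "f \<in> Arr ?S" "src ?S g = tgt ?S f"
  obtain \<alpha> w \<beta> v where [simp]: "g = (\<alpha>, w)" "f = (\<beta>, v)" by (metis prod.exhaust)
  show "FArr ?P (cmp ?S g f) = cmp \<Lambda> (FArr ?P g) (FArr ?P f)"
    using gf category_cmp[OF category_star_graph[OF fg cat T] gf]
    by (simp add: star_proj_simps star_graph_simps(6))
qed (simp_all add: star_proj_def star_graph_simps)

text \<open>Arrows leaving \<open>v\<close> are the pairs \<open>(\<alpha>, v)\<close>, so lifting
  from a source is immediate. Lifting from a target means solving for the point on which
  \<open>\<alpha>\<close> acts, which is possible in exactly one way because \<open>G\<close> is a
  groupoid. Nonempty fibres give surjectivity on vertices and on morphisms.\<close>

lemma covering_star: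
  assumes fg: "fundamental_groupoid t \<Lambda> G i" and \<Lambda>: "k_graph k \<Lambda>" and T: "action G V T"
    and ne: "fibres_nonempty G T"
  shows "covering k \<Lambda> (star_graph \<Lambda> i V T) (star_proj \<Lambda> i V T)" (is "covering k \<Lambda> ?S ?P")
  unfolding covering_def
proof (intro conjI ballI)
  have cat: "category \<Lambda>" using \<Lambda> by (simp add: k_graph_def)
  have gG: "groupoid G" using fg by (simp add: fundamental_groupoid_def)
  note oG = fundamental_groupoid_Obj[OF fg]
  note fP = is_functor_star_proj[OF fg cat T]
  show "k_graph k ?S" by (rule k_graph_star_graph[OF fg \<Lambda> T])
  have "deg \<Lambda> (FArr ?P \<mu>) = deg ?S \<mu>" if "\<mu> \<in> Arr ?S" for \<mu>
    using that by (cases \<mu>) (simp add: star_proj_simps star_graph_simps(7))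
  then show "kgraph_morphism ?S \<Lambda> ?P" using fP by (simp add: kgraph_morphism_def)
  have "x \<in> FObj ?P ` Obj ?S" if x: "x \<in> Obj \<Lambda>" for x
  proof -
    obtain v where "v \<in> FObj T x" using ne x oG by (auto simp: fibres_nonempty_def)
    then show ?thesis
      using action_in[OF T, of x v] base_point_eq[OF T oG x] x oG
      by (intro image_eqI[of _ _ v]) (simp_all add: star_proj_simps star_graph_simps)
  qed
  then show "FObj ?P ` Obj ?S = Obj \<Lambda>" using functor_Obj[OF fP] by blast
  have "\<alpha> \<in> FArr ?P ` Arr ?S" if a: "\<alpha> \<in> Arr \<Lambda>" for \<alpha>
  proof -
    obtain v where "v \<in> FObj T (src \<Lambda> \<alpha>)"
      using ne category_src[OF cat a] oG by (auto simp: fibres_nonempty_def)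
    then have "(\<alpha>, v) \<in> Arr ?S" using a by (simp add: star_graph_simps)
    then show ?thesis using star_proj_simps(2) by (metis image_eqI)
  qed
  then show "FArr ?P ` Arr ?S = Arr \<Lambda>" using functor_Arr[OF fP] by blast
  fix v assume "v \<in> Obj ?S"
  then have v: "v \<in> V" by (simp add: star_graph_simps)
  note b = base_point_fibre[OF T oG v]
  show "bij_betw (FArr ?P) (arrows_from ?S v) (arrows_from \<Lambda> (FObj ?P v))"
  proof (rule bij_betw_byWitness[where f' = "\<lambda>\<alpha>. (\<alpha>, v)"])
    show "\<forall>\<mu>\<in>arrows_from ?S v. (FArr ?P \<mu>, v) = \<mu>"
      by (auto simp: arrows_from_def star_proj_simps star_graph_simps(3))
    show "\<forall>\<alpha>\<in>arrows_from \<Lambda> (FObj ?P v). FArr ?P (\<alpha>, v) = \<alpha>"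
      using b v by (auto simp: arrows_from_def star_proj_simps star_graph_simps)
    show "FArr ?P ` arrows_from ?S v \<subseteq> arrows_from \<Lambda> (FObj ?P v)"
      using functor_Arr[OF fP] functor_src[OF fP] by (auto simp: arrows_from_def)
    show "(\<lambda>\<alpha>. (\<alpha>, v)) ` arrows_from \<Lambda> (FObj ?P v) \<subseteq> arrows_from ?S v"
      using b v by (auto simp: arrows_from_def star_proj_simps star_graph_simps)
  qed
  have bij: "bij_betw (act T (FArr i \<alpha>)) (FObj T (src \<Lambda> \<alpha>)) (FObj T (tgt \<Lambda> \<alpha>))"
    if "\<alpha> \<in> Arr \<Lambda>" for \<alpha>
    using bij_betw_act[OF gG action_functor[OF T] fundamental_groupoid_arr[OF fg that]]
    by (simp add: fundamental_groupoid_src[OF fg cat that] fundamental_groupoid_tgt[OF fg cat that])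
  show "bij_betw (FArr ?P) (arrows_to ?S v) (arrows_to \<Lambda> (FObj ?P v))"
    unfolding bij_betw_def
  proof (intro conjI inj_onI equalityI subsetI)
    fix \<mu> \<nu> assume "\<mu> \<in> arrows_to ?S v" "\<nu> \<in> arrows_to ?S v" "FArr ?P \<mu> = FArr ?P \<nu>"
    then obtain \<alpha> u w where "\<mu> = (\<alpha>, u)" "\<nu> = (\<alpha>, w)" "\<alpha> \<in> Arr \<Lambda>" "u \<in> FObj T (src \<Lambda> \<alpha>)"
      "w \<in> FObj T (src \<Lambda> \<alpha>)" "act T (FArr i \<alpha>) u = act T (FArr i \<alpha>) w"
      by (cases \<mu>; cases \<nu>) (auto simp: arrows_to_def star_proj_simps star_graph_simps)
    then show "\<mu> = \<nu>" using bij_betw_imp_inj_on[OF bij] by (auto dest: inj_onD)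
  next
    fix \<alpha> assume "\<alpha> \<in> FArr ?P ` arrows_to ?S v"
    then show "\<alpha> \<in> arrows_to \<Lambda> (FObj ?P v)"
      using functor_Arr[OF fP] functor_tgt[OF fP] by (auto simp: arrows_to_def)
  next
    fix \<alpha> assume "\<alpha> \<in> arrows_to \<Lambda> (FObj ?P v)"
    then have a: "\<alpha> \<in> Arr \<Lambda>" "v \<in> FObj T (tgt \<Lambda> \<alpha>)"
      using b(2) v by (auto simp: arrows_to_def star_proj_simps)
    then obtain w where "w \<in> FObj T (src \<Lambda> \<alpha>)" "v = act T (FArr i \<alpha>) w"
      using bij by (auto simp: bij_betw_def)
    then have "(\<alpha>, w) \<in> arrows_to ?S v" "FArr ?P (\<alpha>, w) = \<alpha>"
      using a(1) by (auto simp: arrows_to_def star_graph_simps star_proj_simps)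
    then show "\<alpha> \<in> FArr ?P ` arrows_to ?S v" by (metis image_eqI)
  qed
qed

section \<open>Maps of actions as morphisms of coverings\<close>

lemma star_map_simps:
  "v \<in> V \<Longrightarrow> FObj (star_map \<Lambda> i (V, T) \<phi>) v = \<phi> v"
  "(\<alpha>, v) \<in> Arr (star_graph \<Lambda> i V T) \<Longrightarrow> FArr (star_map \<Lambda> i (V, T) \<phi>) (\<alpha>, v) = (\<alpha>, \<phi> v)"
  by (simp_all add: star_map_def)

text \<open>Equivariance is what matches targets. Preservation of fibres keeps
  \<open>(\<alpha>, \<phi> v)\<close> among the arrows and leaves base points unchanged, so that
  identities go to identities and the projections agree.\<close>

lemma covering_morphism_star_map:
  assumes fg: "fundamental_groupoid t \<Lambda> G i" and \<Lambda>: "k_graph k \<Lambda>"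
    and T: "action G V T" "fibres_nonempty G T" and U: "action G U S" "fibres_nonempty G S"
    and \<phi>: "action_morphism G V T U S \<phi>"
  shows "covering_morphism (star_graph \<Lambda> i V T) (star_proj \<Lambda> i V T)
    (star_graph \<Lambda> i U S) (star_proj \<Lambda> i U S) (star_map \<Lambda> i (V, T) \<phi>)"
    (is "covering_morphism ?X ?P ?Y ?Q ?F")
proof -
  have cat: "category \<Lambda>" using \<Lambda> by (simp add: k_graph_def)
  note oG = fundamental_groupoid_Obj[OF fg]
  note cX = category_star_graph[OF fg cat T(1)]
  have fib: "\<phi> v \<in> FObj S x" if "x \<in> Obj \<Lambda>" "v \<in> FObj T x" for x v
    using that \<phi> oG unfolding action_morphism_def by blast
  have in_U: "\<phi> v \<in> U" if "v \<in> V" for v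
    using that \<phi> by (auto simp: action_morphism_def)
  have base: "base_point \<Lambda> S (\<phi> v) = base_point \<Lambda> T v" if "v \<in> V" for v
    using base_point_eq[OF U(1) oG] fib base_point_fibre[OF T(1) oG that] by simp
  have eqv: "\<phi> (act T (FArr i \<alpha>) v) = act S (FArr i \<alpha>) (\<phi> v)"
    if "\<alpha> \<in> Arr \<Lambda>" "v \<in> FObj T (src \<Lambda> \<alpha>)" for \<alpha> v
    using that \<phi> fundamental_groupoid_arr[OF fg that(1)]
      fundamental_groupoid_src[OF fg cat that(1)] by (simp add: action_morphism_def)
  have arr: "(\<alpha>, \<phi> v) \<in> Arr ?Y" if "(\<alpha>, v) \<in> Arr ?X" for \<alpha> v
    using that fib category_src[OF cat] by (simp add: star_graph_simps)
  have F: "is_functor ?X ?Y ?F"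
  proof (rule is_functorI)
    fix f assume f: "f \<in> Arr ?X"
    then obtain \<alpha> v where [simp]: "f = (\<alpha>, v)" and a: "\<alpha> \<in> Arr \<Lambda>" "v \<in> FObj T (src \<Lambda> \<alpha>)"
      by (cases f) (simp add: star_graph_simps)
    show "FArr ?F f \<in> Arr ?Y" "src ?Y (FArr ?F f) = FObj ?F (src ?X f)"
      "tgt ?Y (FArr ?F f) = FObj ?F (tgt ?X f)"
      using f arr star_fibre[OF fg cat T(1) a] star_act_in[OF fg cat T(1) a] eqv[OF a]
      by (simp_all add: star_map_simps star_graph_simps(3,4))
  next
    fix v assume v: "v \<in> Obj ?X"
    then show "FObj ?F v \<in> Obj ?Y" using in_U by (simp add: star_map_simps star_graph_simps)
    show "FArr ?F (ident ?X v) = ident ?Y (FObj ?F v)"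
      using v category_ident[OF cX v] base
      by (simp add: star_map_simps star_graph_simps(1,5))
  next
    fix g f assume gf: "g \<in> Arr ?X" "f \<in> Arr ?X" "src ?X g = tgt ?X f"
    obtain \<alpha> w \<beta> v where [simp]: "g = (\<alpha>, w)" "f = (\<beta>, v)" by (metis prod.exhaust)
    show "FArr ?F (cmp ?X g f) = cmp ?Y (FArr ?F g) (FArr ?F f)"
      using gf category_cmp[OF cX gf] by (simp add: star_map_simps star_graph_simps(6))
  qed (simp_all add: star_map_def star_graph_simps)
  show ?thesis
  proof (rule covering_morphismI[OF covering_star[OF fg \<Lambda> T] covering_star[OF fg \<Lambda> U] F])
    show "FObj ?Q (FObj ?F v) = FObj ?P v" if "v \<in> Obj ?X" for v
      using that in_U base by (simp add: star_graph_simps star_map_simps star_proj_simps)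
    show "FArr ?Q (FArr ?F \<mu>) = FArr ?P \<mu>" if "\<mu> \<in> Arr ?X" for \<mu>
      using that arr by (cases \<mu>) (simp add: star_map_simps star_proj_simps)
  qed
qed

text \<open>The arrow \<open>(\<alpha>, v)\<close> projects to \<open>\<alpha>\<close>, starts at
  \<open>v\<close> and ends at \<open>act T (FArr i \<alpha>) v\<close> by construction, so
  \<open>T\<close> itself meets the description that characterizes the lifted action.\<close>

lemma lift_action_star:
  fixes T :: "('x, 'g, 'v) set_functor" and \<Lambda> :: "('x, 'a) kgraph"
  assumes fg: "fundamental_groupoid TYPE('v sets) \<Lambda> G i" and \<Lambda>: "k_graph k \<Lambda>"
    and T: "action G V T" "fibres_nonempty G T"
  shows "lift_action G i (star_graph \<Lambda> i V T) (star_proj \<Lambda> i V T) = T"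
proof -
  have cat: "category \<Lambda>" using \<Lambda> by (simp add: k_graph_def)
  note oG = fundamental_groupoid_Obj[OF fg]
  show ?thesis
  proof (rule lift_action_eqI[OF fg cat covering_star[OF fg \<Lambda> T]])
    show "action G (Obj (star_graph \<Lambda> i V T)) T" using T by (simp add: star_graph_simps)
    show "FObj T x = vertex_fibre (star_graph \<Lambda> i V T) (star_proj \<Lambda> i V T) x" if "x \<in> Obj G" for x
      using that oG action_in[OF T(1) that] base_point_eq[OF T(1) oG]
        base_point_fibre[OF T(1) oG]
      by (auto simp: vertex_fibre_def star_graph_simps star_proj_simps)
    show "act T (FArr i (FArr (star_proj \<Lambda> i V T) \<mu>)) (src (star_graph \<Lambda> i V T) \<mu>) =
        tgt (star_graph \<Lambda> i V T) \<mu>" if "\<mu> \<in> Arr (star_graph \<Lambda> i V T)" for \<mu>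
      using that by (cases \<mu>) (simp add: star_proj_simps star_graph_simps(3,4))
  qed
qed

section \<open>The equivalence\<close>

lemma action_to_covering_simps:
  assumes "action G V T" "fibres_nonempty G T"
  shows "FObj (action_to_covering \<Lambda> G i) (V, T) = (star_graph \<Lambda> i V T, star_proj \<Lambda> i V T)"
    and "action G U S \<Longrightarrow> fibres_nonempty G S \<Longrightarrow> action_morphism G V T U S \<phi> \<Longrightarrow>
      FArr (action_to_covering \<Lambda> G i) ((V, T), \<phi>, (U, S)) =
        ((star_graph \<Lambda> i V T, star_proj \<Lambda> i V T), star_map \<Lambda> i (V, T) \<phi>,
         (star_graph \<Lambda> i U S, star_proj \<Lambda> i U S))"
  using assms by (simp_all add: action_to_covering_def action_cat_simps star_cov_def)

lemma covering_to_action_simps: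
  assumes "covering k \<Lambda> \<Omega> p"
  shows "FObj (covering_to_action k \<Lambda> G i) (\<Omega>, p) = (Obj \<Omega>, lift_action G i \<Omega> p)"
    and "covering k \<Lambda> \<Sigma> q \<Longrightarrow> covering_morphism \<Omega> p \<Sigma> q \<phi> \<Longrightarrow>
      FArr (covering_to_action k \<Lambda> G i) ((\<Omega>, p), \<phi>, (\<Sigma>, q)) =
        ((Obj \<Omega>, lift_action G i \<Omega> p), FObj \<phi>, (Obj \<Sigma>, lift_action G i \<Sigma> q))"
proof -
  show "FObj (covering_to_action k \<Lambda> G i) (\<Omega>, p) = (Obj \<Omega>, lift_action G i \<Omega> p)"
    using assms by (simp add: covering_to_action_def covering_cat_simps vertex_action_def)
  assume q: "covering k \<Lambda> \<Sigma> q" and \<phi>: "covering_morphism \<Omega> p \<Sigma> q \<phi>"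
  have "restrict (FObj \<phi>) (Obj \<Omega>) = FObj \<phi>"
    using functor_extensional_Obj[OF covering_morphism_functor[OF \<phi>]]
    by (rule extensional_restrict)
  then show "FArr (covering_to_action k \<Lambda> G i) ((\<Omega>, p), \<phi>, (\<Sigma>, q)) =
      ((Obj \<Omega>, lift_action G i \<Omega> p), FObj \<phi>, (Obj \<Sigma>, lift_action G i \<Sigma> q))"
    using assms q \<phi> by (simp add: covering_to_action_def covering_cat_simps vertex_action_def)
qed

lemma is_functor_action_to_covering:
  fixes \<Lambda> :: "('x, 'a) kgraph" and G :: "('x, 'g) cat"
  assumes fg: "fundamental_groupoid t \<Lambda> G i" and \<Lambda>: "k_graph k \<Lambda>"
  shows "is_functor (action_cat G :: (('x, 'g, 'v) actn, ('x, 'g, 'v) actn_arrow) cat)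
    (covering_cat k \<Lambda>) (action_to_covering \<Lambda> G i)"
    (is "is_functor ?A ?C ?F")
proof (rule is_functorI)
  have cat: "category \<Lambda>" using \<Lambda> by (simp add: k_graph_def)
  note cA = category_action_cat[OF fundamental_groupoid_category[OF fg]]
  {
    fix f assume f: "f \<in> Arr ?A"
    obtain V T \<phi> U S where [simp]: "f = ((V, T), \<phi>, (U, S))" by (metis prod.exhaust)
    have T: "action G V T" "fibres_nonempty G T" and U: "action G U S" "fibres_nonempty G S"
      and \<phi>: "action_morphism G V T U S \<phi>"
      using f by (simp_all add: action_cat_simps)
    show "FArr ?F f \<in> Arr ?C" "src ?C (FArr ?F f) = FObj ?F (src ?A f)"
      "tgt ?C (FArr ?F f) = FObj ?F (tgt ?A f)"
      using covering_star[OF fg \<Lambda> T] covering_star[OF fg \<Lambda> U]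
        covering_morphism_star_map[OF fg \<Lambda> T U \<phi>]
      by (simp_all add: action_to_covering_simps[OF T] action_to_covering_simps[OF U] U \<phi>
          action_cat_simps covering_cat_simps)
  next
    fix x assume x: "x \<in> Obj ?A"
    obtain V T where [simp]: "x = (V, T)" by (cases x)
    have T: "action G V T" "fibres_nonempty G T" using x by (simp_all add: action_cat_simps)
    show "FObj ?F x \<in> Obj ?C"
      using covering_star[OF fg \<Lambda> T] by (simp add: action_to_covering_simps[OF T] covering_cat_simps)
    have id: "action_morphism G V T V T (restrict (\<lambda>v. v) V)"
      using category_ident[OF cA x] by (simp add: action_cat_simps)
    have "star_map \<Lambda> i (V, T) (restrict (\<lambda>v. v) V) = fid (star_graph \<Lambda> i V T)"
    proof (rule functor_eqI[OF covering_morphism_functor[OF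
            covering_morphism_star_map[OF fg \<Lambda> T T id]]
          is_functor_fid[OF category_star_graph[OF fg cat T(1)]]])
      show "FArr (star_map \<Lambda> i (V, T) (restrict (\<lambda>v. v) V)) \<mu> = FArr (fid (star_graph \<Lambda> i V T)) \<mu>"
        if "\<mu> \<in> Arr (star_graph \<Lambda> i V T)" for \<mu>
        using that star_fibre(1)[OF fg cat T(1), of "fst \<mu>" "snd \<mu>"]
        by (cases \<mu>) (simp add: star_map_simps fctr_simps star_graph_simps(2))
    qed (simp add: star_map_simps star_graph_simps FObj_fid)
    then show "FArr ?F (ident ?A x) = ident ?C (FObj ?F x)"
      by (simp add: action_to_covering_simps[OF T] T id action_cat_simps covering_cat_simps)
  next
    fix g f assume gf: "g \<in> Arr ?A" "f \<in> Arr ?A" "src ?A g = tgt ?A f"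
    obtain V T \<phi> U S \<psi> W R where [simp]: "f = ((V, T), \<phi>, (U, S))" "g = ((U, S), \<psi>, (W, R))"
      using gf(3) by (cases f; cases g) (auto simp: action_cat_simps)
    have T: "action G V T" "fibres_nonempty G T" and U: "action G U S" "fibres_nonempty G S"
      and W: "action G W R" "fibres_nonempty G R"
      and \<phi>: "action_morphism G V T U S \<phi>" and \<psi>: "action_morphism G U S W R \<psi>"
      using gf by (simp_all add: action_cat_simps)
    \<comment> \<open>That a composite of equivariant maps is equivariant is read off from
      \<open>action_cat\<close> being a category.\<close>
    have \<psi>\<phi>: "action_morphism G V T W R (compose V \<psi> \<phi>)"
      using category_cmp[OF cA gf] by (simp add: action_cat_simps)
    note f\<phi> = covering_morphism_functor[OF covering_morphism_star_map[OF fg \<Lambda> T U \<phi>]]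
    note f\<psi> = covering_morphism_functor[OF covering_morphism_star_map[OF fg \<Lambda> U W \<psi>]]
    have "star_map \<Lambda> i (V, T) (compose V \<psi> \<phi>) =
        fcomp (star_graph \<Lambda> i V T) (star_map \<Lambda> i (U, S) \<psi>) (star_map \<Lambda> i (V, T) \<phi>)"
    proof (rule functor_eqI[OF covering_morphism_functor[OF
            covering_morphism_star_map[OF fg \<Lambda> T W \<psi>\<phi>]]
          is_functor_fcomp[OF category_star_graph[OF fg cat T(1)] f\<phi> f\<psi>]])
      show "FObj (star_map \<Lambda> i (V, T) (compose V \<psi> \<phi>)) v =
          FObj (fcomp (star_graph \<Lambda> i V T) (star_map \<Lambda> i (U, S) \<psi>) (star_map \<Lambda> i (V, T) \<phi>)) v"
        if "v \<in> Obj (star_graph \<Lambda> i V T)" for v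
        using that functor_Obj[OF f\<phi> that]
        by (simp add: FObj_fcomp star_map_simps star_graph_simps(1) compose_eq)
      show "FArr (star_map \<Lambda> i (V, T) (compose V \<psi> \<phi>)) \<mu> =
          FArr (fcomp (star_graph \<Lambda> i V T) (star_map \<Lambda> i (U, S) \<psi>) (star_map \<Lambda> i (V, T) \<phi>)) \<mu>"
        if "\<mu> \<in> Arr (star_graph \<Lambda> i V T)" for \<mu>
      proof -
        obtain \<alpha> v where [simp]: "\<mu> = (\<alpha>, v)" by (cases \<mu>)
        have "v \<in> V"
          using that star_fibre(1)[OF fg cat T(1), of \<alpha> v] by (simp add: star_graph_simps)
        then show ?thesis
          using that functor_Arr[OF f\<phi> that] by (simp add: FArr_fcomp star_map_simps compose_eq)
      qed
    qed
    then show "FArr ?F (cmp ?A g f) = cmp ?C (FArr ?F g) (FArr ?F f)"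
      by (simp add: action_to_covering_simps[OF T] action_to_covering_simps[OF U] U W \<phi> \<psi> \<psi>\<phi>
          action_cat_simps(6) covering_cat_simps(6))
  }
qed (simp_all add: action_to_covering_def)

lemma is_functor_covering_to_action:
  fixes \<Lambda> :: "('x, 'a) kgraph" and G :: "('x, 'g) cat"
  assumes fg: "fundamental_groupoid TYPE('v sets) \<Lambda> G i" and \<Lambda>: "k_graph k \<Lambda>"
  shows "is_functor (covering_cat k \<Lambda> :: (('x, 'a, 'v) cov, ('x, 'a, 'v) cov_arrow) cat)
    (action_cat G) (covering_to_action k \<Lambda> G i)"
    (is "is_functor ?C ?A ?F")
proof (rule is_functorI)
  have cat: "category \<Lambda>" using \<Lambda> by (simp add: k_graph_def)
  note cC = category_covering_cat
  note L = action_lift_action[OF fg cat] fibres_nonempty_lift_action[OF fg cat]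
  {
    fix f assume f: "f \<in> Arr ?C"
    obtain \<Omega> p \<phi> \<Sigma> q where [simp]: "f = ((\<Omega>, p), \<phi>, (\<Sigma>, q))" by (metis prod.exhaust)
    have c: "covering k \<Lambda> \<Omega> p" "covering k \<Lambda> \<Sigma> q" "covering_morphism \<Omega> p \<Sigma> q \<phi>"
      using f by (simp_all add: covering_cat_simps)
    show "FArr ?F f \<in> Arr ?A" "src ?A (FArr ?F f) = FObj ?F (src ?C f)"
      "tgt ?A (FArr ?F f) = FObj ?F (tgt ?C f)"
      using action_morphism_of_covering_morphism[OF fg cat c] L[OF c(1)] L[OF c(2)]
      by (simp_all add: covering_to_action_simps[OF c(1)] covering_to_action_simps[OF c(2)] c
          action_cat_simps covering_cat_simps)
  next
    fix x assume x: "x \<in> Obj ?C"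
    obtain \<Omega> p where [simp]: "x = (\<Omega>, p)" by (cases x)
    have p: "covering k \<Lambda> \<Omega> p" using x by (simp add: covering_cat_simps)
    show "FObj ?F x \<in> Obj ?A"
      using L[OF p] by (simp add: covering_to_action_simps[OF p] action_cat_simps)
    have "covering_morphism \<Omega> p \<Omega> p (fid \<Omega>)"
      using category_ident[OF cC x] by (simp add: covering_cat_simps)
    then show "FArr ?F (ident ?C x) = ident ?A (FObj ?F x)"
      by (simp add: covering_to_action_simps[OF p] p action_cat_simps covering_cat_simps)
        (simp add: fid_def)
  next
    fix g f assume gf: "g \<in> Arr ?C" "f \<in> Arr ?C" "src ?C g = tgt ?C f"
    obtain \<Omega> p \<phi> \<Sigma> q \<psi> \<Theta> t where [simp]: "f = ((\<Omega>, p), \<phi>, (\<Sigma>, q))" "g = ((\<Sigma>, q), \<psi>, (\<Theta>, t))"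
      using gf(3) by (cases f; cases g) (auto simp: covering_cat_simps)
    have c: "covering k \<Lambda> \<Omega> p" "covering k \<Lambda> \<Sigma> q" "covering k \<Lambda> \<Theta> t"
      "covering_morphism \<Omega> p \<Sigma> q \<phi>" "covering_morphism \<Sigma> q \<Theta> t \<psi>"
      using gf by (simp_all add: covering_cat_simps)
    have "covering_morphism \<Omega> p \<Theta> t (fcomp \<Omega> \<psi> \<phi>)"
      using category_cmp[OF cC gf] by (simp add: covering_cat_simps)
    then show "FArr ?F (cmp ?C g f) = cmp ?A (FArr ?F g) (FArr ?F f)"
      by (simp add: covering_to_action_simps[OF c(1)] covering_to_action_simps[OF c(2)] c
          action_cat_simps(6) covering_cat_simps(6))
        (simp add: fcomp_def)
  }
qed (simp_all add: covering_to_action_def)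

text \<open>An equality of functors is possible because the star graph has \<open>V\<close> itself
  as its set of vertices, \<open>lift_action_star\<close> returns \<open>T\<close>, and
  \<open>star_map\<close> is \<open>\<phi>\<close> on vertices, both maps being extensional.\<close>

lemma covering_to_action_action_to_covering:
  fixes \<Lambda> :: "('x, 'a) kgraph" and G :: "('x, 'g) cat"
  assumes fg: "fundamental_groupoid TYPE('v sets) \<Lambda> G i" and \<Lambda>: "k_graph k \<Lambda>"
  shows "fcomp (action_cat G) (covering_to_action k \<Lambda> G i) (action_to_covering \<Lambda> G i) =
    fid (action_cat G :: (('x, 'g, 'v) actn, ('x, 'g, 'v) actn_arrow) cat)"
    (is "fcomp ?A ?H ?F = fid ?A")
proof (rule functor_eqI)
  note cA = category_action_cat[OF fundamental_groupoid_category[OF fg]]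
  show "is_functor ?A ?A (fcomp ?A ?H ?F)"
    by (rule is_functor_fcomp[OF cA is_functor_action_to_covering[OF fg \<Lambda>]
          is_functor_covering_to_action[OF fg \<Lambda>]])
  show "is_functor ?A ?A (fid ?A)" by (rule is_functor_fid[OF cA])
  fix x assume x: "x \<in> Obj ?A"
  obtain V T where [simp]: "x = (V, T)" by (cases x)
  have T: "action G V T" "fibres_nonempty G T" using x by (simp_all add: action_cat_simps)
  show "FObj (fcomp ?A ?H ?F) x = FObj (fid ?A) x"
    using x by (simp add: fctr_simps action_to_covering_simps[OF T] star_graph_simps(1)
        covering_to_action_simps[OF covering_star[OF fg \<Lambda> T]] lift_action_star[OF fg \<Lambda> T])
next
  fix f assume f: "f \<in> Arr ?A"
  obtain V T \<phi> U S where [simp]: "f = ((V, T), \<phi>, (U, S))" by (metis prod.exhaust)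
  have T: "action G V T" "fibres_nonempty G T" and U: "action G U S" "fibres_nonempty G S"
    and \<phi>: "action_morphism G V T U S \<phi>"
    using f by (simp_all add: action_cat_simps)
  have "FObj (star_map \<Lambda> i (V, T) \<phi>) = \<phi>"
    using \<phi> by (auto simp: star_map_def action_morphism_def intro: extensional_restrict PiE_restrict)
  then show "FArr (fcomp ?A ?H ?F) f = FArr (fid ?A) f"
    using f by (simp add: fctr_simps action_to_covering_simps[OF T] U \<phi> star_graph_simps(1)
        covering_to_action_simps[OF covering_star[OF fg \<Lambda> T]] covering_star[OF fg \<Lambda> U]
        covering_morphism_star_map[OF fg \<Lambda> T U \<phi>] lift_action_star[OF fg \<Lambda> T]
        lift_action_star[OF fg \<Lambda> U])
qed

section \<open>Comparison of a covering with the star covering of its vertex action\<close>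

definition star_counit :: "('x, 'a) kgraph \<Rightarrow> ('x, 'g) cat \<Rightarrow> ('x, 'a, 'x, 'g) fctr \<Rightarrow>
    ('v, 'm) kgraph \<Rightarrow> ('v, 'm, 'x, 'a) fctr \<Rightarrow> ('v, 'a \<times> 'v, 'v, 'm) fctr" where
  "star_counit \<Lambda> G i \<Omega> p = \<lparr>FObj = restrict (\<lambda>v. v) (Obj \<Omega>),
     FArr = restrict (\<lambda>(\<alpha>, v). path_lift \<Omega> p \<alpha> v)
       (Arr (star_graph \<Lambda> i (Obj \<Omega>) (lift_action G i \<Omega> p)))\<rparr>"

definition star_counit_inv :: "('v, 'm) kgraph \<Rightarrow> ('v, 'm, 'x, 'a) fctr \<Rightarrow>
    ('v, 'm, 'v, 'a \<times> 'v) fctr" where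
  "star_counit_inv \<Omega> p = \<lparr>FObj = restrict (\<lambda>v. v) (Obj \<Omega>),
     FArr = restrict (\<lambda>\<mu>. (FArr p \<mu>, src \<Omega> \<mu>)) (Arr \<Omega>)\<rparr>"

context
  fixes \<Lambda> :: "('x, 'a) kgraph" and G :: "('x, 'g) cat" and i :: "('x, 'a, 'x, 'g) fctr"
    and \<Omega> :: "('v, 'm) kgraph" and p :: "('v, 'm, 'x, 'a) fctr" and k :: nat
  assumes fg: "fundamental_groupoid TYPE('v sets) \<Lambda> G i" and \<Lambda>: "k_graph k \<Lambda>"
    and p: "covering k \<Lambda> \<Omega> p"
begin

abbreviation (input) "lifted \<equiv> lift_action G i \<Omega> p"
abbreviation (input) "lifted_star \<equiv> star_graph \<Lambda> i (Obj \<Omega>) lifted"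

lemma category_base: "category \<Lambda>"
  using \<Lambda> by (simp add: k_graph_def)

lemma star_lift_Arr:
  "(\<alpha>, v) \<in> Arr lifted_star \<longleftrightarrow> \<alpha> \<in> Arr \<Lambda> \<and> v \<in> vertex_fibre \<Omega> p (src \<Lambda> \<alpha>)"
  using FObj_lift_action[OF fg category_base p] fundamental_groupoid_Obj[OF fg]
    category_src[OF category_base]
  by (auto simp: star_graph_simps)

lemma covering_star_lift: "covering k \<Lambda> lifted_star (star_proj \<Lambda> i (Obj \<Omega>) lifted)"
  by (rule covering_star[OF fg \<Lambda> action_lift_action[OF fg category_base p]
        fibres_nonempty_lift_action[OF fg category_base p]])

lemma base_point_lift:
  assumes "v \<in> Obj \<Omega>"
  shows "base_point \<Lambda> lifted v = FObj p v"
proof (rule base_point_eq[OF action_lift_action[OF fg category_base p]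
      fundamental_groupoid_Obj[OF fg]])
  show x: "FObj p v \<in> Obj \<Lambda>" using functor_Obj[OF covering_functor[OF p] assms] .
  show "v \<in> FObj lifted (FObj p v)"
    using FObj_lift_action[OF fg category_base p, of "FObj p v"] x fundamental_groupoid_Obj[OF fg]
      assms by (simp add: vertex_fibre_def)
qed

lemma star_counit_simps:
  "v \<in> Obj \<Omega> \<Longrightarrow> FObj (star_counit \<Lambda> G i \<Omega> p) v = v"
  "\<alpha> \<in> Arr \<Lambda> \<Longrightarrow> v \<in> vertex_fibre \<Omega> p (src \<Lambda> \<alpha>) \<Longrightarrow>
     FArr (star_counit \<Lambda> G i \<Omega> p) (\<alpha>, v) = path_lift \<Omega> p \<alpha> v"
  "v \<in> Obj \<Omega> \<Longrightarrow> FObj (star_counit_inv \<Omega> p) v = v"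
  "\<mu> \<in> Arr \<Omega> \<Longrightarrow> FArr (star_counit_inv \<Omega> p) \<mu> = (FArr p \<mu>, src \<Omega> \<mu>)"
  by (simp_all add: star_counit_def star_counit_inv_def star_lift_Arr)

text \<open>Describing the comparison by lifting, and not as an inverse map, reduces functoriality
  to \<open>path_lift_ident\<close> and \<open>path_lift_cmp\<close>; targets agree because the
  lifted action moves \<open>v\<close> to the end of the lift.\<close>

lemma covering_morphism_star_counit:
  "covering_morphism lifted_star (star_proj \<Lambda> i (Obj \<Omega>) lifted) \<Omega> p (star_counit \<Lambda> G i \<Omega> p)"
proof (rule covering_morphismI[OF covering_star_lift p])
  note cS = covering_category[OF covering_star_lift] and c\<Omega> = covering_category[OF p]
  show "is_functor lifted_star \<Omega> (star_counit \<Lambda> G i \<Omega> p)"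
  proof (rule is_functorI)
    fix f assume "f \<in> Arr lifted_star"
    then obtain \<alpha> v where [simp]: "f = (\<alpha>, v)"
      and a: "\<alpha> \<in> Arr \<Lambda>" "v \<in> vertex_fibre \<Omega> p (src \<Lambda> \<alpha>)"
      by (cases f) (simp add: star_lift_Arr)
    have v: "v \<in> Obj \<Omega>" using a(2) by (simp add: vertex_fibre_def)
    note l = path_lift_Arr[OF p a] src_path_lift[OF p a]
    show "FArr (star_counit \<Lambda> G i \<Omega> p) f \<in> Arr \<Omega>"
      "src \<Omega> (FArr (star_counit \<Lambda> G i \<Omega> p) f) = FObj (star_counit \<Lambda> G i \<Omega> p) (src lifted_star f)"
      "tgt \<Omega> (FArr (star_counit \<Lambda> G i \<Omega> p) f) = FObj (star_counit \<Lambda> G i \<Omega> p) (tgt lifted_star f)"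
      using a v l category_tgt[OF c\<Omega> l(1)]
      by (simp_all add: star_counit_simps star_graph_simps(3,4)
          act_lift_action[OF fg category_base p])
  next
    fix v assume v: "v \<in> Obj lifted_star"
    then have v': "v \<in> vertex_fibre \<Omega> p (FObj p v)" "v \<in> Obj \<Omega>"
      by (simp_all add: vertex_fibre_def star_graph_simps)
    then show "FObj (star_counit \<Lambda> G i \<Omega> p) v \<in> Obj \<Omega>" by (simp add: star_counit_simps)
    show "FArr (star_counit \<Lambda> G i \<Omega> p) (ident lifted_star v) = ident \<Omega> (FObj (star_counit \<Lambda> G i \<Omega> p) v)"
      using category_ident[OF cS v] path_lift_ident[OF p v'(1)] v'(2)
      by (simp add: star_graph_simps(5) base_point_lift star_lift_Arr star_counit_simps)
  next
    fix g f assume gf: "g \<in> Arr lifted_star" "f \<in> Arr lifted_star" "src lifted_star g = tgt lifted_star f"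
    obtain \<alpha> w \<beta> v where [simp]: "g = (\<alpha>, w)" "f = (\<beta>, v)" by (metis prod.exhaust)
    have ab: "\<alpha> \<in> Arr \<Lambda>" "w \<in> vertex_fibre \<Omega> p (src \<Lambda> \<alpha>)"
      "\<beta> \<in> Arr \<Lambda>" "v \<in> vertex_fibre \<Omega> p (src \<Lambda> \<beta>)"
      using gf by (simp_all add: star_lift_Arr)
    have w: "w = tgt \<Omega> (path_lift \<Omega> p \<beta> v)"
      using gf(3) act_lift_action[OF fg category_base p ab(3,4)] by (simp add: star_graph_simps)
    then have m: "src \<Lambda> \<alpha> = tgt \<Lambda> \<beta>"
      using tgt_path_lift[OF p ab(3,4)] ab(2) by (simp add: vertex_fibre_def)
    show "FArr (star_counit \<Lambda> G i \<Omega> p) (cmp lifted_star g f) =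
        cmp \<Omega> (FArr (star_counit \<Lambda> G i \<Omega> p) g) (FArr (star_counit \<Lambda> G i \<Omega> p) f)"
      using category_cmp[OF cS gf] ab path_lift_cmp[OF p ab(1,3) m ab(4)] w
      by (simp add: star_graph_simps(6) star_lift_Arr star_counit_simps)
  qed (simp_all add: star_counit_def star_graph_simps)
  show "FObj p (FObj (star_counit \<Lambda> G i \<Omega> p) v) = FObj (star_proj \<Lambda> i (Obj \<Omega>) lifted) v"
    if "v \<in> Obj lifted_star" for v
    using that by (simp add: star_graph_simps star_counit_simps star_proj_simps base_point_lift)
  show "FArr p (FArr (star_counit \<Lambda> G i \<Omega> p) \<mu>) = FArr (star_proj \<Lambda> i (Obj \<Omega>) lifted) \<mu>"
    if "\<mu> \<in> Arr lifted_star" for \<mu>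
    using that FArr_path_lift[OF p]
    by (cases \<mu>) (simp add: star_lift_Arr star_counit_simps star_proj_simps)
qed

lemma covering_morphism_star_counit_inv:
  "covering_morphism \<Omega> p lifted_star (star_proj \<Lambda> i (Obj \<Omega>) lifted) (star_counit_inv \<Omega> p)"
proof (rule covering_morphismI[OF p covering_star_lift])
  note c\<Omega> = covering_category[OF p] and fp = covering_functor[OF p]
  have arr: "(FArr p \<mu>, src \<Omega> \<mu>) \<in> Arr lifted_star" if "\<mu> \<in> Arr \<Omega>" for \<mu>
    using src_in_vertex_fibre[OF p that] functor_Arr[OF fp that] by (simp add: star_lift_Arr)
  show "is_functor \<Omega> lifted_star (star_counit_inv \<Omega> p)"
  proof (rule is_functorI)
    fix \<mu> assume \<mu>: "\<mu> \<in> Arr \<Omega>"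
    \<comment> \<open>The lift of \<open>FArr p \<mu>\<close> at the source of \<open>\<mu>\<close>
      is \<open>\<mu>\<close> itself, so the lifted action sends that source to the target of
      \<open>\<mu>\<close>.\<close>
    show "FArr (star_counit_inv \<Omega> p) \<mu> \<in> Arr lifted_star"
      "src lifted_star (FArr (star_counit_inv \<Omega> p) \<mu>) = FObj (star_counit_inv \<Omega> p) (src \<Omega> \<mu>)"
      "tgt lifted_star (FArr (star_counit_inv \<Omega> p) \<mu>) = FObj (star_counit_inv \<Omega> p) (tgt \<Omega> \<mu>)"
      using arr[OF \<mu>] category_src[OF c\<Omega> \<mu>] category_tgt[OF c\<Omega> \<mu>]
        act_lift_action[OF fg category_base p functor_Arr[OF fp \<mu>] src_in_vertex_fibre[OF p \<mu>]]
        path_lift_eqI[OF p \<mu> refl refl] \<mu>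
      by (simp_all add: star_counit_simps star_graph_simps(3,4))
  next
    fix v assume v: "v \<in> Obj \<Omega>"
    then show "FObj (star_counit_inv \<Omega> p) v \<in> Obj lifted_star"
      by (simp add: star_counit_simps star_graph_simps)
    show "FArr (star_counit_inv \<Omega> p) (ident \<Omega> v) = ident lifted_star (FObj (star_counit_inv \<Omega> p) v)"
      by (simp add: v star_counit_simps star_graph_simps category_ident[OF c\<Omega> v]
          category_src_ident[OF c\<Omega> v] functor_ident[OF fp v] base_point_lift)
  next
    fix g f assume gf: "g \<in> Arr \<Omega>" "f \<in> Arr \<Omega>" "src \<Omega> g = tgt \<Omega> f"
    show "FArr (star_counit_inv \<Omega> p) (cmp \<Omega> g f) =
        cmp lifted_star (FArr (star_counit_inv \<Omega> p) g) (FArr (star_counit_inv \<Omega> p) f)"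
      by (simp add: gf(1,2) star_counit_simps star_graph_simps(6) category_cmp[OF c\<Omega> gf]
          category_src_cmp[OF c\<Omega> gf] functor_cmp[OF fp gf])
  qed (simp_all add: star_counit_inv_def)
  show "FObj (star_proj \<Lambda> i (Obj \<Omega>) lifted) (FObj (star_counit_inv \<Omega> p) v) = FObj p v"
    if "v \<in> Obj \<Omega>" for v
    using that by (simp add: star_counit_simps star_proj_simps base_point_lift)
  show "FArr (star_proj \<Lambda> i (Obj \<Omega>) lifted) (FArr (star_counit_inv \<Omega> p) \<mu>) = FArr p \<mu>"
    if "\<mu> \<in> Arr \<Omega>" for \<mu>
    using arr[OF that] that by (simp add: star_counit_simps star_proj_simps)
qed

lemma star_counit_inverse:
  "fcomp lifted_star (star_counit_inv \<Omega> p) (star_counit \<Lambda> G i \<Omega> p) = fid lifted_star"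
  "fcomp \<Omega> (star_counit \<Lambda> G i \<Omega> p) (star_counit_inv \<Omega> p) = fid \<Omega>"
proof -
  note cS = covering_category[OF covering_star_lift] and c\<Omega> = covering_category[OF p]
  note f = covering_morphism_functor[OF covering_morphism_star_counit]
  note g = covering_morphism_functor[OF covering_morphism_star_counit_inv]
  show "fcomp lifted_star (star_counit_inv \<Omega> p) (star_counit \<Lambda> G i \<Omega> p) = fid lifted_star"
  proof (rule functor_eqI[OF is_functor_fcomp[OF cS f g] is_functor_fid[OF cS]])
    show "FArr (fcomp lifted_star (star_counit_inv \<Omega> p) (star_counit \<Lambda> G i \<Omega> p)) \<mu> = FArr (fid lifted_star) \<mu>"
      if "\<mu> \<in> Arr lifted_star" for \<mu>
      using that path_lift_Arr[OF p] src_path_lift[OF p] FArr_path_lift[OF p]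
      by (cases \<mu>) (simp add: fctr_simps star_counit_simps star_lift_Arr)
  qed (simp add: fctr_simps star_counit_simps star_graph_simps)
  show "fcomp \<Omega> (star_counit \<Lambda> G i \<Omega> p) (star_counit_inv \<Omega> p) = fid \<Omega>"
  proof (rule functor_eqI[OF is_functor_fcomp[OF c\<Omega> g f] is_functor_fid[OF c\<Omega>]])
    show "FArr (fcomp \<Omega> (star_counit \<Lambda> G i \<Omega> p) (star_counit_inv \<Omega> p)) \<mu> = FArr (fid \<Omega>) \<mu>"
      if "\<mu> \<in> Arr \<Omega>" for \<mu>
      using that functor_Arr[OF covering_functor[OF p] that] src_in_vertex_fibre[OF p that]
        path_lift_eqI[OF p that refl refl]
      by (simp add: fctr_simps star_counit_simps)
  qed (simp add: fctr_simps star_counit_simps)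
qed

end

text \<open>Each component is invertible by uniqueness of lifts, with inverse
  \<open>star_counit_inv\<close>. For naturality, both composites act as \<open>FObj \<phi>\<close>
  on vertices, and on morphisms the square is \<open>path_lift_covering_morphism\<close>.\<close>

lemma natural_iso_star_counit:
  fixes \<Lambda> :: "('x, 'a) kgraph" and G :: "('x, 'g) cat"
  assumes fg: "fundamental_groupoid TYPE('v sets) \<Lambda> G i" and \<Lambda>: "k_graph k \<Lambda>"
  shows "natural_iso (covering_cat k \<Lambda>) (covering_cat k \<Lambda>)
    (fcomp (covering_cat k \<Lambda>) (action_to_covering \<Lambda> G i) (covering_to_action k \<Lambda> G i))
    (fid (covering_cat k \<Lambda> :: (('x, 'a, 'v) cov, ('x, 'a, 'v) cov_arrow) cat))
    (\<lambda>(\<Omega>, p). (star_cov \<Lambda> i (vertex_action G i (\<Omega>, p)), star_counit \<Lambda> G i \<Omega> p, (\<Omega>, p)))"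
    (is "natural_iso ?C ?C (fcomp ?C ?F ?H) _ ?\<epsilon>")
  unfolding natural_iso_def
proof (intro conjI ballI)
  have cat: "category \<Lambda>" using \<Lambda> by (simp add: k_graph_def)
  have obj: "FObj (fcomp ?C ?F ?H) (\<Omega>, p) = (star_graph \<Lambda> i (Obj \<Omega>) (lift_action G i \<Omega> p),
      star_proj \<Lambda> i (Obj \<Omega>) (lift_action G i \<Omega> p))"
    if "covering k \<Lambda> \<Omega> p" for \<Omega> :: "('v, 'a \<times> 'v) kgraph" and p
    using that by (simp add: FObj_fcomp covering_cat_simps covering_to_action_simps
        action_to_covering_simps action_lift_action[OF fg cat] fibres_nonempty_lift_action[OF fg cat])
  fix x assume x: "x \<in> Obj ?C"
  obtain \<Omega> p where [simp]: "x = (\<Omega>, p)" by (cases x)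
  have p: "covering k \<Lambda> \<Omega> p" using x by (simp add: covering_cat_simps)
  let ?S = "star_graph \<Lambda> i (Obj \<Omega>) (lift_action G i \<Omega> p)"
  let ?P = "star_proj \<Lambda> i (Obj \<Omega>) (lift_action G i \<Omega> p)"
  show "src ?C (?\<epsilon> x) = FObj (fcomp ?C ?F ?H) x" "tgt ?C (?\<epsilon> x) = FObj (fid ?C) x"
    using x by (simp_all add: star_cov_def vertex_action_def obj[OF p] covering_cat_simps(3,4) FObj_fid)
  show "is_iso ?C (?\<epsilon> x)"
    unfolding is_iso_def
  proof (intro conjI bexI[of _ "((\<Omega>, p), star_counit_inv \<Omega> p, (?S, ?P))"])
    show "?\<epsilon> x \<in> Arr ?C" "((\<Omega>, p), star_counit_inv \<Omega> p, (?S, ?P)) \<in> Arr ?C"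
      using covering_star_lift[OF fg \<Lambda> p] covering_morphism_star_counit[OF fg \<Lambda> p]
        covering_morphism_star_counit_inv[OF fg \<Lambda> p] p
      by (simp_all add: star_cov_def vertex_action_def covering_cat_simps(2))
  qed (simp_all add: star_cov_def vertex_action_def covering_cat_simps(3-6)
      star_counit_inverse[OF fg \<Lambda> p])
next
  have cat: "category \<Lambda>" using \<Lambda> by (simp add: k_graph_def)
  fix f assume f: "f \<in> Arr ?C"
  obtain \<Omega> p \<phi> \<Sigma> q where [simp]: "f = ((\<Omega>, p), \<phi>, (\<Sigma>, q))" by (metis prod.exhaust)
  have p: "covering k \<Lambda> \<Omega> p" and q: "covering k \<Lambda> \<Sigma> q" and \<phi>: "covering_morphism \<Omega> p \<Sigma> q \<phi>"
    using f by (simp_all add: covering_cat_simps)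
  note Lp = action_lift_action[OF fg cat p] fibres_nonempty_lift_action[OF fg cat p]
  note Lq = action_lift_action[OF fg cat q] fibres_nonempty_lift_action[OF fg cat q]
  note m = action_morphism_of_covering_morphism[OF fg cat p q \<phi>]
  let ?S = "star_graph \<Lambda> i (Obj \<Omega>) (lift_action G i \<Omega> p)"
  let ?\<psi> = "star_map \<Lambda> i (Obj \<Omega>, lift_action G i \<Omega> p) (FObj \<phi>)"
  note f\<phi> = covering_morphism_functor[OF \<phi>]
  note f\<psi> = covering_morphism_functor[OF covering_morphism_star_map[OF fg \<Lambda> Lp Lq m]]
  note \<epsilon>p = covering_morphism_functor[OF covering_morphism_star_counit[OF fg \<Lambda> p]]
  note \<epsilon>q = covering_morphism_functor[OF covering_morphism_star_counit[OF fg \<Lambda> q]]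
  note cS = covering_category[OF covering_star_lift[OF fg \<Lambda> p]]
  have "fcomp ?S (star_counit \<Lambda> G i \<Sigma> q) ?\<psi> = fcomp ?S \<phi> (star_counit \<Lambda> G i \<Omega> p)"
  proof (rule functor_eqI[OF is_functor_fcomp[OF cS f\<psi> \<epsilon>q] is_functor_fcomp[OF cS \<epsilon>p f\<phi>]])
    show "FObj (fcomp ?S (star_counit \<Lambda> G i \<Sigma> q) ?\<psi>) v =
        FObj (fcomp ?S \<phi> (star_counit \<Lambda> G i \<Omega> p)) v" if "v \<in> Obj ?S" for v
      using that functor_Obj[OF f\<phi>, of v]
      by (simp add: fctr_simps star_graph_simps(1) star_map_simps star_counit_simps[OF fg \<Lambda> p]
          star_counit_simps[OF fg \<Lambda> q])
    show "FArr (fcomp ?S (star_counit \<Lambda> G i \<Sigma> q) ?\<psi>) \<mu> =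
        FArr (fcomp ?S \<phi> (star_counit \<Lambda> G i \<Omega> p)) \<mu>" if \<mu>: "\<mu> \<in> Arr ?S" for \<mu>
    proof -
      obtain \<alpha> v where [simp]: "\<mu> = (\<alpha>, v)" by (cases \<mu>)
      have a: "\<alpha> \<in> Arr \<Lambda>" "v \<in> vertex_fibre \<Omega> p (src \<Lambda> \<alpha>)"
        using \<mu> by (simp_all add: star_lift_Arr[OF fg \<Lambda> p])
      show ?thesis
        using \<mu> a covering_morphism_vertex_fibre[OF \<phi> a(2)]
          path_lift_covering_morphism[OF p q \<phi> a]
        by (simp add: fctr_simps star_map_simps star_counit_simps[OF fg \<Lambda> p]
            star_counit_simps[OF fg \<Lambda> q])
    qed
  qed
  then show "cmp ?C (?\<epsilon> (tgt ?C f)) (FArr (fcomp ?C ?F ?H) f) =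
      cmp ?C (FArr (fid ?C) f) (?\<epsilon> (src ?C f))"
    using f by (simp add: fctr_simps covering_to_action_simps[OF p] q \<phi>
        action_to_covering_simps[OF Lp] Lq m covering_cat_simps(3,4,6) star_cov_def
        vertex_action_def)
qed

theorem theorem3p5:
  fixes k :: nat
    and \<Lambda> :: "('x, 'a) kgraph"
    and G :: "('x, 'g) cat"
    and i :: "('x, 'a, 'x, 'g) fctr"
  assumes "k_graph k \<Lambda>"
    and "fundamental_groupoid TYPE('v sets) \<Lambda> G i"
  shows "category_equivalence
           (action_cat G :: (('x, 'g, 'v) actn, ('x, 'g, 'v) actn_arrow) cat)
           (covering_cat k \<Lambda> :: (('x, 'a, 'v) cov, ('x, 'a, 'v) cov_arrow) cat)
           (action_to_covering \<Lambda> G i)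
           (covering_to_action k \<Lambda> G i)"
  \<comment> \<open>Rewriting the composite on actions to \<open>fid\<close> turns the unit into the
    family of identities.\<close>
  unfolding category_equivalence_def covering_to_action_action_to_covering[OF assms(2,1)]
  using category_action_cat[OF fundamental_groupoid_category[OF assms(2)]] category_covering_cat
    is_functor_action_to_covering[OF assms(2,1)] is_functor_covering_to_action[OF assms(2,1)]
    natural_iso_ident[OF category_action_cat[OF fundamental_groupoid_category[OF assms(2)]]]
    natural_iso_star_counit[OF assms(2,1)]
  by blast

end
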